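(* Let $G=\mathbb{Z}_3^2\rtimes Q_8$ be the Frobenius group with Frobenius kernel $\mathbb{Z}_3^2$ and Frobenius complement the quaternion group $Q_8$ of order $8$. Then the Wedderburn decomposition of $T(G)$ is $$T(G)\cong V\oplus Z_1\oplus Z_2\oplus\cdots\oplus Z_8,$$ where $V$ is the primary component and each $Z_i$, $1\le i\le 8$, is a $1$-dimensional ideal of $T(G)$.
   Context: For a finite group $G$ with conjugacy classes $C_0=\{e\},C_1,\dots,C_d$, let $A_i$ be the $G\times G$ matrix with $(A_i)_{xy}=1$ if $yx^{-1}\in C_i$, and $0$ otherwise, and let $E_i^*$ be the diagonal matrix with $(E_i^* )_{yy}=1$ if $y\in C_i$ and $0$ otherwise. $T(G)$ is the subalgebra of $M_{|G|}(\mathbb{C})$ generated by all $A_i$ and $E_i^*$ (the Terwilliger algebra of the group association scheme with base point $e$). It is semisimple; its Wedderburn decomposition is its decomposition as the direct sum of its minimal two-sided ideals. The primary component $V$ is the unique minimal two-sided ideal acting nontrivially on the irreducible module $\mathrm{Span}\{A_0,\dots,A_d\}\hat{e}\subseteq\mathbb{C}^{|G|}$ ($\hat{e}$ the standard basis vector at $e$); $\dim V=(d+1)^2$. *)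

theory Defs
  imports "HOL-Analysis.Analysis" "HOL-Algebra.Group_Action" "HOL-Algebra.Elementary_Groups"
begin

section \<open>Frobenius groups and the quaternion group\<close>

definition frobenius_complement :: "('a, 'b) monoid_scheme \<Rightarrow> 'a set \<Rightarrow> bool" where
  "frobenius_complement G H \<longleftrightarrow>
     group G \<and> subgroup H G \<and> H \<noteq> {\<one>\<^bsub>G\<^esub>} \<and> H \<noteq> carrier G \<and>
     (\<forall>g \<in> carrier G - H. H \<inter> (g <#\<^bsub>G\<^esub> H #>\<^bsub>G\<^esub> inv\<^bsub>G\<^esub> g) = {\<one>\<^bsub>G\<^esub>})"

definition frobenius_kernel :: "('a, 'b) monoid_scheme \<Rightarrow> 'a set \<Rightarrow> 'a set" where
  "frobenius_kernel G H =
     insert \<one>\<^bsub>G\<^esub> (carrier G - (\<Union>g \<in> carrier G. g <#\<^bsub>G\<^esub> H #>\<^bsub>G\<^esub> inv\<^bsub>G\<^esub> g))"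

text \<open>The quadruple \<open>(a, b, c, d)\<close> stands for the quaternion \<open>a + b i + c j + d k\<close>.\<close>

fun quaternion_mult ::
  "int \<times> int \<times> int \<times> int \<Rightarrow> int \<times> int \<times> int \<times> int \<Rightarrow> int \<times> int \<times> int \<times> int" where
  "quaternion_mult (a, b, c, d) (a', b', c', d') =
     (a * a' - b * b' - c * c' - d * d',
      a * b' + b * a' + c * d' - d * c',
      a * c' - b * d' + c * a' + d * b',
      a * d' + b * c' - c * b' + d * a')"

definition quaternion_group :: "(int \<times> int \<times> int \<times> int) monoid" where
  "quaternion_group =
     \<lparr>carrier = {(1, 0, 0, 0), (-1, 0, 0, 0), (0, 1, 0, 0), (0, -1, 0, 0),
                 (0, 0, 1, 0), (0, 0, -1, 0), (0, 0, 0, 1), (0, 0, 0, -1)},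
      mult = quaternion_mult,
      one = (1, 0, 0, 0)\<rparr>"

section \<open>Algebras of complex matrices\<close>

definition cmat_scale :: "complex \<Rightarrow> complex^'n^'n \<Rightarrow> complex^'n^'n" where
  "cmat_scale c A = (\<chi> i j. c * A $ i $ j)"

global_interpretation cmat: vector_space "cmat_scale :: complex \<Rightarrow> complex^'n^'n \<Rightarrow> complex^'n^'n"
  by unfold_locales (simp_all add: cmat_scale_def vec_eq_iff algebra_simps)

definition matrix_subalgebra :: "(complex^'n^'n) set \<Rightarrow> bool" where
  "matrix_subalgebra S \<longleftrightarrow>
     cmat.subspace S \<and> mat 1 \<in> S \<and> (\<forall>A \<in> S. \<forall>B \<in> S. A ** B \<in> S)"

definition two_sided_ideal :: "(complex^'n^'n) set \<Rightarrow> (complex^'n^'n) set \<Rightarrow> bool" where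
  "two_sided_ideal T I \<longleftrightarrow>
     I \<subseteq> T \<and> cmat.subspace I \<and> (\<forall>A \<in> T. \<forall>X \<in> I. A ** X \<in> I \<and> X ** A \<in> I)"

definition minimal_two_sided_ideal :: "(complex^'n^'n) set \<Rightarrow> (complex^'n^'n) set \<Rightarrow> bool" where
  "minimal_two_sided_ideal T I \<longleftrightarrow>
     two_sided_ideal T I \<and> I \<noteq> {0} \<and>
     (\<forall>J. two_sided_ideal T J \<and> J \<subseteq> I \<longrightarrow> J = {0} \<or> J = I)"

text \<open>The bijection says that every element of \<open>T\<close> is uniquely a sum of elements, one from each
  member of \<open>W\<close>, i.e. that \<open>T\<close> is the internal direct sum of \<open>W\<close>.\<close>

definition wedderburn_decomposition ::
  "(complex^'n^'n) set \<Rightarrow> (complex^'n^'n) set set \<Rightarrow> bool" where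
  "wedderburn_decomposition T W \<longleftrightarrow>
     finite W \<and> W = {I. minimal_two_sided_ideal T I} \<and>
     bij_betw (\<lambda>f. \<Sum>I\<in>W. f I) (\<Pi>\<^sub>E I\<in>W. I) T"

section \<open>The Terwilliger algebra of a finite group\<close>

text \<open>The \<open>G \<times> G\<close> matrices are indexed by the finite type that is the carrier of \<open>G\<close>, so below
  \<open>G\<close> is always meant to be a group with \<open>carrier G = UNIV\<close>. The generators are indexed by the
  conjugacy classes themselves instead of by an enumeration of them.\<close>

definition conjugacy_classes :: "('a, 'b) monoid_scheme \<Rightarrow> 'a set set" where
  "conjugacy_classes G =
     orbits G (carrier G) (\<lambda>g. \<lambda>h \<in> carrier G. g \<otimes>\<^bsub>G\<^esub> h \<otimes>\<^bsub>G\<^esub> inv\<^bsub>G\<^esub> g)"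

definition class_matrix :: "('a::finite, 'b) monoid_scheme \<Rightarrow> 'a set \<Rightarrow> complex^'a^'a" where
  "class_matrix G C = (\<chi> x y. if y \<otimes>\<^bsub>G\<^esub> inv\<^bsub>G\<^esub> x \<in> C then 1 else 0)"

definition class_projection :: "'a::finite set \<Rightarrow> complex^'a^'a" where
  "class_projection C = (\<chi> x y. if x = y \<and> y \<in> C then 1 else 0)"

definition terwilliger_algebra :: "('a::finite, 'b) monoid_scheme \<Rightarrow> (complex^'a^'a) set" where
  "terwilliger_algebra G =
     matrix_subalgebra hull
       (class_matrix G ` conjugacy_classes G \<union> class_projection ` conjugacy_classes G)"

definition primary_module :: "('a::finite, 'b) monoid_scheme \<Rightarrow> (complex^'a) set" where
  "primary_module G =
     (\<lambda>A. A *v axis \<one>\<^bsub>G\<^esub> 1) ` cmat.span (class_matrix G ` conjugacy_classes G)"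

definition acts_nontrivially :: "(complex^'n^'n) set \<Rightarrow> (complex^'n) set \<Rightarrow> bool" where
  "acts_nontrivially I M \<longleftrightarrow> (\<exists>A \<in> I. \<exists>v \<in> M. A *v v \<noteq> 0)"

definition is_primary_component ::
  "('a::finite, 'b) monoid_scheme \<Rightarrow> (complex^'a^'a) set \<Rightarrow> bool" where
  "is_primary_component G V \<longleftrightarrow>
     (\<forall>I. minimal_two_sided_ideal (terwilliger_algebra G) I \<and>
            acts_nontrivially I (primary_module G) \<longleftrightarrow> I = V)"

end

theory Submission
  imports Defs "HOL-Algebra.Zassenhaus"
begin

text \<open>
  Let \<open>z\<close> be the central involution of \<open>Q\<^sub>8\<close> and \<open>M = N {\<one>, z}\<close>, a normal subgroup of index 4.
  The complement permutes the eight nontrivial elements of the kernel \<open>N\<close> regularly, and every class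
  outside \<open>N\<close> is a union of cosets of \<open>N\<close>, so it is determined by a class of \<open>Q\<^sub>8\<close>. As two
  noncommuting elements of \<open>Q\<^sub>8\<close> have the commutator \<open>z\<close>, the classes of \<open>G\<close> are
  \<open>{\<one>}\<close>, \<open>N - {\<one>}\<close>, \<open>M - N\<close> and the three cosets \<open>M x\<close> with \<open>x \<notin> M\<close>
  (lemma \<open>frobenius_group_type.layered\<close>).

  Only this shape of the classes matters for the algebra \<open>T\<close>. Cut each of the three outer classes into
  its two cosets of \<open>N\<close>, and leave the other classes as they are. Between the partition of \<open>G\<close> into points
  and the one into classes this gives a third partition, and the averages over the three partitions are
  commuting projections \<open>I\<close>, \<open>P\<^sub>1\<close>, \<open>P\<^sub>2\<close> with decreasing images. They commute
  with the diagonal generators \<open>E\<^sub>C\<close>. Extend the notation \<open>A\<^sub>C\<close> to unions \<open>C\<close> of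
  classes. Every generator \<open>A\<^sub>C\<close> is one of \<open>I\<close>, \<open>A\<^sub>N\<close>, \<open>A\<^sub>M\<close> and
  \<open>A\<^bsub>M x\<^esub>\<close>, or a difference of two of them, and each of these acts on
  \<open>I - P\<^sub>1\<close> and on \<open>P\<^sub>1 - P\<^sub>2\<close> as a scalar
  (lemmas \<open>fine_eigen\<close> and \<open>coarse_eigen\<close>). So \<open>(I - P\<^sub>1) E\<^sub>C\<close> and
  \<open>(P\<^sub>1 - P\<^sub>2) E\<^sub>C\<close> span ideals of dimension at most one. The first one vanishes only for
  \<open>C = {\<one>}\<close>, and the second one exactly for the three classes inside \<open>M\<close>, so there are
  \<open>5 + 3 = 8\<close> lines.

  The remaining summand \<open>P\<^sub>2\<close> of the unit lies in the space of matrices that are constant on the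
  blocks \<open>C \<times> D\<close> given by two classes. For every finite group this space is a full matrix algebra
  and a minimal ideal of \<open>T\<close>, and it acts nontrivially on the primary module
  (theorem \<open>class_blocks_minimal\<close>). On the other hand, the eight lines annihilate the basis vector of
  the base point, which generates the primary module. Since the unit is now a sum of elements of these
  nine minimal ideals, they are all of them, and their sum is direct
  (theorem \<open>wedderburn_decompositionI\<close>).
\<close>

section \<open>Matrix algebras and their minimal two-sided ideals\<close>

lemma cmat_scale_nth [simp]: "cmat_scale c A $ i $ j = c * A $ i $ j"
  by (simp add: cmat_scale_def)

lemma matrix_mult_nth: "(A ** B) $ i $ j = (\<Sum>k\<in>UNIV. A $ i $ k * B $ k $ j)"
  by (simp add: matrix_matrix_mult_def)

lemma cmat_scale_mult_left [simp]: "cmat_scale c A ** B = cmat_scale c (A ** B)"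
  by (simp add: vec_eq_iff matrix_mult_nth sum_distrib_left mult.assoc)

lemma cmat_scale_mult_right [simp]: "A ** cmat_scale c B = cmat_scale c (A ** B)"
  by (simp add: vec_eq_iff matrix_mult_nth sum_distrib_left mult.left_commute)

lemma matrix_mult_zero [simp]:
  fixes A :: "complex^'n^'n"
  shows "0 ** A = 0" "A ** 0 = 0"
  by (simp_all add: vec_eq_iff matrix_mult_nth)

lemma matrix_mult_add_left: "(A + B) ** C = A ** C + B ** (C :: complex^'n^'n)"
  by (simp add: vec_eq_iff matrix_mult_nth sum.distrib distrib_right)

lemma matrix_mult_diff_left: "(A - B) ** C = A ** C - B ** (C :: complex^'n^'n)"
  by (simp add: vec_eq_iff matrix_mult_nth sum_subtractf left_diff_distrib)

lemma matrix_mult_diff_right: "C ** (A - B) = C ** A - C ** (B :: complex^'n^'n)"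
  by (simp add: vec_eq_iff matrix_mult_nth sum_subtractf right_diff_distrib)

lemma matrix_mult_sum_left:
  fixes f :: "'i \<Rightarrow> complex^'n^'n"
  shows "sum f S ** C = (\<Sum>i\<in>S. f i ** C)"
  by (induction S rule: infinite_finite_induct) (simp_all add: vec_eq_iff matrix_mult_nth sum.distrib distrib_right)

lemma matrix_mult_sum_right:
  fixes f :: "'i \<Rightarrow> complex^'n^'n"
  shows "C ** sum f S = (\<Sum>i\<in>S. C ** f i)"
  by (induction S rule: infinite_finite_induct) (simp_all add: matrix_add_ldistrib)

lemma transpose_diff: "transpose (A - B) = transpose A - transpose (B :: complex^'n^'n)"
  by (simp add: vec_eq_iff transpose_def)

lemma transpose_cmat_scale: "transpose (cmat_scale c A) = cmat_scale c (transpose A)"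
  by (simp add: vec_eq_iff transpose_def)

lemma two_sided_idealD:
  assumes "two_sided_ideal T I"
  shows "I \<subseteq> T" "cmat.subspace I"
    and "A \<in> T \<Longrightarrow> X \<in> I \<Longrightarrow> A ** X \<in> I" "A \<in> T \<Longrightarrow> X \<in> I \<Longrightarrow> X ** A \<in> I"
  using assms unfolding two_sided_ideal_def by simp_all

lemma minimal_two_sided_idealD:
  assumes "minimal_two_sided_ideal T I"
  shows "two_sided_ideal T I" "I \<noteq> {0}"
  using assms unfolding minimal_two_sided_ideal_def by simp_all

text \<open>An intersection of ideals is an ideal, so two minimal ideals that meet nontrivially are equal.
  As the product of two ideals lies in their intersection, different minimal ideals annihilate each
  other.\<close>

lemma two_sided_ideal_Int:
  "two_sided_ideal T I \<Longrightarrow> two_sided_ideal T J \<Longrightarrow> two_sided_ideal T (I \<inter> J)"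
  unfolding two_sided_ideal_def by (auto intro: cmat.subspace_inter)

lemma minimal_ideals_eq_if_meet:
  assumes I: "minimal_two_sided_ideal T I" and J: "minimal_two_sided_ideal T J"
    and x: "x \<in> I" "x \<in> J" "x \<noteq> 0"
  shows "I = J"
proof -
  have "two_sided_ideal T (I \<inter> J)"
    using I J two_sided_ideal_Int unfolding minimal_two_sided_ideal_def by blast
  moreover have "I \<inter> J \<noteq> {0}"
    using x by blast
  ultimately have "I \<inter> J = I" "I \<inter> J = J"
    using I J inf_le1[of I J] inf_le2[of I J] unfolding minimal_two_sided_ideal_def by blast+
  then show ?thesis
    by (metis (no_types))
qed

lemma minimal_ideals_annihilate:
  assumes I: "minimal_two_sided_ideal T I" and J: "minimal_two_sided_ideal T J"
    and "I \<noteq> J" "x \<in> I" "y \<in> J"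
  shows "x ** y = 0"
proof (rule ccontr)
  assume "x ** y \<noteq> 0"
  moreover have "x ** y \<in> I" "x ** y \<in> J"
    using two_sided_idealD[OF minimal_two_sided_idealD(1)[OF I]]
      two_sided_idealD[OF minimal_two_sided_idealD(1)[OF J]] \<open>x \<in> I\<close> \<open>y \<in> J\<close> by (meson subsetD)+
  ultimately show False
    using minimal_ideals_eq_if_meet[OF I J] \<open>I \<noteq> J\<close> by blast
qed

text \<open>A decomposition of the unit matrix along some minimal ideals is enough. Multiplying an element
  by the idem_index \<open>e I\<close> of the unit projects it to the ideals, so there is no room for
  a further minimal ideal, every element is a sum of its projections, and the summands are determined
  by the sum.\<close>

theorem wedderburn_decompositionI:
  fixes T :: "(complex^'n^'n) set"
  assumes T: "matrix_subalgebra T" and fin: "finite W"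
    and min: "\<And>I. I \<in> W \<Longrightarrow> minimal_two_sided_ideal T I"
    and e: "\<And>I. I \<in> W \<Longrightarrow> e I \<in> I" and one: "mat 1 = (\<Sum>I\<in>W. e I)"
  shows "wedderburn_decomposition T W"
proof -
  have ideal: "two_sided_ideal T I" if "I \<in> W" for I
    by (rule minimal_two_sided_idealD(1)[OF min[OF that]])
  have eT: "e I \<in> T" if "I \<in> W" for I
    using e[OF that] two_sided_idealD(1)[OF ideal[OF that]] by (rule rev_subsetD)
  have expand: "x = (\<Sum>I\<in>W. x ** e I)" for x
    using matrix_mult_sum_right[of x e W] one by (metis matrix_mul_rid)
  have "minimal_two_sided_ideal T I \<longleftrightarrow> I \<in> W" for I
  proof
    assume I: "minimal_two_sided_ideal T I"
    then have "I \<noteq> {0}" "0 \<in> I"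
      using minimal_two_sided_idealD two_sided_idealD(2) cmat.subspace_0 by metis+
    then obtain x where x: "x \<in> I" "x \<noteq> 0"
      by blast
    obtain J where J: "J \<in> W" "x ** e J \<noteq> 0"
      using expand[of x] \<open>x \<noteq> 0\<close> by (metis sum.neutral)
    then have "I = J"
      using minimal_ideals_annihilate[OF I min[OF J(1)] _ x(1) e[OF J(1)]] by argo
    then show "I \<in> W"
      using J by simp
  qed (rule min)
  then have W: "W = {I. minimal_two_sided_ideal T I}"
    by blast
  have component: "(\<Sum>I\<in>W. f I) ** e J = f J" if f: "f \<in> (\<Pi>\<^sub>E I\<in>W. I)" and J: "J \<in> W" for f J
  proof -
    have annih: "f J' ** e I = 0" if "I \<in> W" "J' \<in> W" "I \<noteq> J'" for I J'
      using minimal_ideals_annihilate[OF min[OF that(2)] min[OF that(1)] _ _ e[OF that(1)]]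
        PiE_mem[OF f that(2)] that(3) by metis
    have "(\<Sum>I\<in>W. f I) ** e J = (\<Sum>I\<in>W. if I = J then f J ** e J else 0)"
      unfolding matrix_mult_sum_left using annih J by (intro sum.cong) auto
    also have "\<dots> = (\<Sum>I\<in>W. f J ** e I)"
      using annih J by (intro sum.cong) auto
    also have "\<dots> = f J"
      by (rule expand[symmetric])
    finally show ?thesis .
  qed
  have "bij_betw (\<lambda>f. \<Sum>I\<in>W. f I) (\<Pi>\<^sub>E I\<in>W. I) T"
    unfolding bij_betw_def
  proof
    show "inj_on (\<lambda>f. \<Sum>I\<in>W. f I) (\<Pi>\<^sub>E I\<in>W. I)"
      by (rule inj_onI) (metis (no_types, lifting) PiE_ext component)
    show "(\<lambda>f. \<Sum>I\<in>W. f I) ` (\<Pi>\<^sub>E I\<in>W. I) = T"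
    proof
      show "(\<lambda>f. \<Sum>I\<in>W. f I) ` (\<Pi>\<^sub>E I\<in>W. I) \<subseteq> T"
      proof (rule image_subsetI)
        fix f assume "f \<in> (\<Pi>\<^sub>E I\<in>W. I)"
        then have "f I \<in> T" if "I \<in> W" for I
          using two_sided_idealD(1)[OF ideal[OF that]] PiE_mem that by blast
        then show "(\<Sum>I\<in>W. f I) \<in> T"
          using T unfolding matrix_subalgebra_def by (blast intro: cmat.subspace_sum)
      qed
      show "T \<subseteq> (\<lambda>f. \<Sum>I\<in>W. f I) ` (\<Pi>\<^sub>E I\<in>W. I)"
      proof
        fix x assume x: "x \<in> T"
        let ?f = "\<lambda>I\<in>W. x ** e I"
        have "?f \<in> (\<Pi>\<^sub>E I\<in>W. I)"
          using two_sided_idealD(3)[OF ideal x e] by simp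
        moreover have "x = (\<Sum>I\<in>W. ?f I)"
          using expand[of x] by simp
        ultimately show "x \<in> (\<lambda>f. \<Sum>I\<in>W. f I) ` (\<Pi>\<^sub>E I\<in>W. I)"
          by blast
      qed
    qed
  qed
  then show ?thesis
    unfolding wedderburn_decomposition_def using fin W by simp
qed

lemma cmat_span_singleton: "cmat.span {z} = range (\<lambda>c. cmat_scale c z)"
  by (rule cmat.span_singleton)

lemma dim_line: "z \<noteq> 0 \<Longrightarrow> cmat.dim (cmat.span {z}) = 1"
  by (simp add: cmat.dim_eq_card_independent)

lemma line_minimal_two_sided_ideal:
  assumes "two_sided_ideal T (cmat.span {z})" "z \<noteq> 0"
  shows "minimal_two_sided_ideal T (cmat.span {z})"
  unfolding minimal_two_sided_ideal_def
proof (intro conjI allI impI)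
  show "cmat.span {z} \<noteq> {0}"
    using assms(2) cmat.span_base[of z "{z}"] by auto
  fix J assume J: "two_sided_ideal T J \<and> J \<subseteq> cmat.span {z}"
  then have sub: "cmat.subspace J"
    unfolding two_sided_ideal_def by blast
  show "J = {0} \<or> J = cmat.span {z}"
  proof (cases "J = {0}")
    case False
    then obtain c where c: "cmat_scale c z \<in> J" "cmat_scale c z \<noteq> 0"
      using J cmat.subspace_0[OF sub] unfolding cmat_span_singleton by blast
    then have "c \<noteq> 0"
      by auto
    then have "z = cmat_scale (1 / c) (cmat_scale c z)"
      by (simp add: cmat.scale_scale)
    then have "z \<in> J"
      using cmat.subspace_scale[OF sub c(1)] by metis
    then have "cmat.span {z} \<subseteq> J"
      using cmat.span_minimal[OF _ sub] by blast
    then show ?thesis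
      using J by blast
  qed simp
qed (use assms in blast)

section \<open>Averaging over the blocks of a partition\<close>

text \<open>\<open>B x\<close> is the block that contains \<open>x\<close>.\<close>

definition blocks :: "('a \<Rightarrow> 'a set) \<Rightarrow> bool" where
  "blocks B \<longleftrightarrow> (\<forall>x. x \<in> B x) \<and> (\<forall>x y. y \<in> B x \<longrightarrow> B y = B x)"

definition averaging :: "('a::finite \<Rightarrow> 'a set) \<Rightarrow> complex^'a^'a" where
  "averaging B = (\<chi> x y. if y \<in> B x then 1 / of_nat (card (B x)) else 0)"

lemma blocks_sym: "blocks B \<Longrightarrow> y \<in> B x \<longleftrightarrow> x \<in> B y"
  unfolding blocks_def by metis

lemma averaging_nth: "averaging B $ x $ y = (if y \<in> B x then 1 / of_nat (card (B x)) else 0)"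
  by (simp add: averaging_def)

lemma transpose_averaging:
  assumes "blocks B"
  shows "transpose (averaging B) = averaging B"
  using assms blocks_sym[OF assms]
  by (simp add: vec_eq_iff transpose_def averaging_nth) (metis blocks_def)

lemma mult_averaging_right:
  assumes B: "blocks B" and A: "\<And>x y w. w \<in> B y \<Longrightarrow> A $ x $ w = A $ x $ y"
  shows "A ** averaging B = A"
proof -
  have "(A ** averaging B) $ x $ w = A $ x $ w" for x w
  proof -
    have "(A ** averaging B) $ x $ w = (\<Sum>y\<in>UNIV. if y \<in> B w then A $ x $ w / of_nat (card (B w)) else 0)"
      unfolding matrix_mult_nth averaging_nth
      using A B blocks_sym[OF B] by (intro sum.cong) (auto simp: blocks_def)
    also have "\<dots> = A $ x $ w"
      using B unfolding blocks_def by (subst sum.If_cases) (auto simp: card_eq_0_iff)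
    finally show ?thesis .
  qed
  then show ?thesis
    by (simp add: vec_eq_iff)
qed

lemma mult_averaging_left:
  assumes B: "blocks B" and A: "\<And>x y w. w \<in> B x \<Longrightarrow> A $ w $ y = A $ x $ y"
  shows "averaging B ** A = A"
proof -
  have "transpose A ** averaging B = transpose A"
    by (rule mult_averaging_right[OF B]) (simp add: transpose_def A)
  then have "transpose (transpose A ** averaging B) = A"
    by simp
  then show ?thesis
    by (simp only: matrix_transpose_mul transpose_averaging[OF B] transpose_transpose)
qed

lemma averaging_refine:
  assumes B: "blocks B" and B': "blocks B'" and le: "\<And>x. B x \<subseteq> B' x"
  shows "averaging B ** averaging B' = averaging B'"
proof (rule mult_averaging_left[OF B])
  fix x y w assume "w \<in> B x"
  then have "B' w = B' x"
    using le B' unfolding blocks_def by blast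
  then show "averaging B' $ w $ y = averaging B' $ x $ y"
    by (simp add: averaging_nth)
qed

lemma class_projection_mult_nth:
  "(class_projection C ** A) $ x $ y = (if x \<in> C then A $ x $ y else 0)"
proof -
  have "(class_projection C ** A) $ x $ y = (\<Sum>k\<in>UNIV. if k = x then (if x \<in> C then A $ x $ y else 0) else 0)"
    unfolding matrix_mult_nth by (intro sum.cong) (auto simp: class_projection_def)
  then show ?thesis
    by simp
qed

lemma mult_class_projection_nth:
  "(A ** class_projection C) $ x $ y = (if y \<in> C then A $ x $ y else 0)"
proof -
  have "(A ** class_projection C) $ x $ y = (\<Sum>k\<in>UNIV. if k = y then (if y \<in> C then A $ x $ y else 0) else 0)"
    unfolding matrix_mult_nth by (intro sum.cong) (auto simp: class_projection_def)
  then show ?thesis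
    by simp
qed

lemma class_projection_mult_class_projection:
  "class_projection C ** class_projection D = class_projection (C \<inter> D)"
  by (simp add: vec_eq_iff class_projection_mult_nth) (simp add: class_projection_def)

lemma class_projection_empty: "class_projection {} = 0"
  by (simp add: vec_eq_iff class_projection_def)

lemma transpose_class_projection: "transpose (class_projection C) = class_projection C"
  by (auto simp: vec_eq_iff transpose_def class_projection_def)

lemma class_projection_commutes_averaging:
  assumes B: "blocks B" and C: "\<And>x. x \<in> C \<Longrightarrow> B x \<subseteq> C"
  shows "class_projection C ** averaging B = averaging B ** class_projection C"
proof -
  have "x \<in> C \<longleftrightarrow> y \<in> C" if "y \<in> B x" for x y
    using that C blocks_sym[OF B] by blast
  then show ?thesis
    by (simp add: vec_eq_iff class_projection_mult_nth mult_class_projection_nth averaging_nth)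
qed

section \<open>The primary component of the Terwilliger algebra of a finite group\<close>

locale finite_group_type = group G for G :: "('g::finite) monoid" (structure) +
  assumes carrier_UNIV [simp]: "carrier G = UNIV"
begin

abbreviation T :: "(complex^'g^'g) set" where
  "T \<equiv> terwilliger_algebra G"

definition conj_class :: "'g \<Rightarrow> 'g set" where
  "conj_class x = range (\<lambda>g. g \<otimes> x \<otimes> inv g)"

lemma conjugacy_classes_eq: "conjugacy_classes G = range conj_class"
  by (auto simp: conjugacy_classes_def orbits_def orbit_def conj_class_def)

lemma mem_conj_class: "y \<in> conj_class x \<longleftrightarrow> (\<exists>g. y = g \<otimes> x \<otimes> inv g)"
  by (auto simp: conj_class_def)

lemma conj_conj: "h \<otimes> (g \<otimes> x \<otimes> inv g) \<otimes> inv h = (h \<otimes> g) \<otimes> x \<otimes> inv (h \<otimes> g)"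
  by (simp add: inv_mult_group m_assoc)

lemma inv_conj_conj [simp]:
  "inv g \<otimes> (g \<otimes> x \<otimes> inv g) \<otimes> g = x" "g \<otimes> (inv g \<otimes> x \<otimes> g) \<otimes> inv g = x"
proof -
  show "inv g \<otimes> (g \<otimes> x \<otimes> inv g) \<otimes> g = x"
    using conj_conj[of "inv g" g x] by simp
  show "g \<otimes> (inv g \<otimes> x \<otimes> g) \<otimes> inv g = x"
    using conj_conj[of g "inv g" x] by simp
qed

lemma conj_mult: "(g \<otimes> y \<otimes> inv g) \<otimes> (g \<otimes> x \<otimes> inv g) = g \<otimes> (y \<otimes> x) \<otimes> inv g"
proof -
  have "inv g \<otimes> (g \<otimes> (x \<otimes> inv g)) = x \<otimes> inv g"
    by (metis UNIV_I carrier_UNIV inv_solve_left')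
  then show ?thesis
    by (simp add: m_assoc)
qed

lemma conj_inv: "inv (g \<otimes> x \<otimes> inv g) = g \<otimes> inv x \<otimes> inv g"
  by (simp add: inv_mult_group m_assoc)

lemma mem_coset: "y \<in> S #> x \<longleftrightarrow> y \<otimes> inv x \<in> S"
proof
  assume "y \<in> S #> x"
  then show "y \<otimes> inv x \<in> S"
    by (auto simp: r_coset_def m_assoc)
next
  assume "y \<otimes> inv x \<in> S"
  moreover have "y = (y \<otimes> inv x) \<otimes> x"
    by (simp add: m_assoc)
  ultimately show "y \<in> S #> x"
    unfolding r_coset_def by blast
qed

lemma blocks_coset:
  assumes S: "subgroup S G"
  shows "blocks (\<lambda>x. S #> x)"
  unfolding blocks_def
proof (intro conjI allI impI)
  fix x y
  show "x \<in> S #> x"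
    using S by (simp add: rcos_self)
  show "y \<in> S #> x \<Longrightarrow> S #> y = S #> x"
    using S by (metis UNIV_I carrier_UNIV repr_independence)
qed

lemma card_coset: "subgroup S G \<Longrightarrow> card (S #> x) = card S"
  by (metis UNIV_I carrier_UNIV card_rcosets_equal rcosetsI subset_UNIV)

lemma coset_eq_iff: "subgroup S G \<Longrightarrow> S #> x = S \<longleftrightarrow> x \<in> S"
  by (metis UNIV_I carrier_UNIV coset_join1 coset_join2 subset_UNIV)

lemma coset_self: "subgroup S G \<Longrightarrow> x \<in> S \<Longrightarrow> S #> x = S"
  by (simp add: coset_eq_iff)

lemma blocks_conj_class: "blocks conj_class"
  unfolding blocks_def
proof (intro conjI allI impI)
  fix x y
  show "x \<in> conj_class x"
    unfolding mem_conj_class by (rule exI[of _ \<one>]) simp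
  assume "y \<in> conj_class x"
  then obtain g where g: "y = g \<otimes> x \<otimes> inv g"
    unfolding mem_conj_class by blast
  have x: "x = inv g \<otimes> y \<otimes> inv (inv g)"
    unfolding g by simp
  show "conj_class y = conj_class x"
  proof (intro equalityI subsetI)
    fix w assume "w \<in> conj_class y"
    then obtain h where "w = h \<otimes> y \<otimes> inv h"
      unfolding mem_conj_class by blast
    then show "w \<in> conj_class x"
      unfolding mem_conj_class g conj_conj by blast
  next
    fix w assume "w \<in> conj_class x"
    then obtain h where "w = h \<otimes> x \<otimes> inv h"
      unfolding mem_conj_class by blast
    then have "w = h \<otimes> inv g \<otimes> y \<otimes> inv (h \<otimes> inv g)"
      by (subst (asm) x) (simp only: conj_conj)
    then show "w \<in> conj_class y"
      unfolding mem_conj_class by blast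
  qed
qed

lemma conj_class_self [simp]: "x \<in> conj_class x"
  and conj_class_eq: "y \<in> conj_class x \<Longrightarrow> conj_class y = conj_class x"
  using blocks_conj_class unfolding blocks_def by blast+

lemma conj_mem_conj_class: "g \<otimes> w \<otimes> inv g \<in> conj_class z \<longleftrightarrow> w \<in> conj_class z"
proof -
  have "g \<otimes> w \<otimes> inv g \<in> conj_class w"
    unfolding mem_conj_class by blast
  then have "conj_class (g \<otimes> w \<otimes> inv g) = conj_class w"
    by (rule conj_class_eq)
  then show ?thesis
    using conj_class_eq conj_class_self by metis
qed

lemma conj_class_conj: "conj_class (g \<otimes> w \<otimes> inv g) = conj_class w"
  by (rule conj_class_eq) (simp add: conj_mem_conj_class)

lemma card_conj_class [simp]: "card (conj_class x) \<noteq> 0" "conj_class x \<noteq> {}"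
  using conj_class_self[of x] by (auto simp: card_eq_0_iff simp del: conj_class_self)

lemma conj_class_disjoint: "conj_class x \<noteq> conj_class y \<Longrightarrow> conj_class x \<inter> conj_class y = {}"
  using conj_class_eq by blast

lemma conj_class_one: "conj_class \<one> = {\<one>}"
  by (auto simp: conj_class_def)

lemma inv_mem_conj_class: "inv y \<in> conj_class x \<longleftrightarrow> y \<in> conj_class (inv x)"
  unfolding mem_conj_class by (metis UNIV_I carrier_UNIV conj_inv inv_inv)

lemma matrix_subalgebra_T: "matrix_subalgebra T"
  unfolding terwilliger_algebra_def
proof (rule hull_in)
  fix \<S> :: "(complex^'g^'g) set set"
  assume "Ball \<S> matrix_subalgebra"
  then show "matrix_subalgebra (\<Inter>\<S>)"
    unfolding matrix_subalgebra_def by (auto intro: cmat.subspace_Inter)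
qed

lemma
  shows T_subspace: "cmat.subspace T"
    and T_one: "mat 1 \<in> T"
    and T_mult: "A \<in> T \<Longrightarrow> B \<in> T \<Longrightarrow> A ** B \<in> T"
  using matrix_subalgebra_T unfolding matrix_subalgebra_def by simp_all

lemma class_matrix_in_T: "class_matrix G (conj_class x) \<in> T"
  unfolding terwilliger_algebra_def conjugacy_classes_eq by (rule hull_inc) blast

lemma class_projection_in_T: "class_projection (conj_class x) \<in> T"
  unfolding terwilliger_algebra_def conjugacy_classes_eq by (rule hull_inc) blast

lemma T_induct [consumes 1, case_names class_matrix class_projection one zero add scale mult]:
  assumes A: "A \<in> T"
    and "\<And>x. P (class_matrix G (conj_class x))" "\<And>x. P (class_projection (conj_class x))"
    and "P (mat 1)" "P 0" "\<And>A B. P A \<Longrightarrow> P B \<Longrightarrow> P (A + B)"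
    and "\<And>c A. P A \<Longrightarrow> P (cmat_scale c A)" "\<And>A B. P A \<Longrightarrow> P B \<Longrightarrow> P (A ** B)"
  shows "P A"
proof -
  have "T \<subseteq> {A. P A}"
    unfolding terwilliger_algebra_def conjugacy_classes_eq
    using assms(2-) by (intro hull_minimal) (auto simp: matrix_subalgebra_def cmat.subspace_def)
  then show ?thesis
    using A by blast
qed

lemma class_matrix_nth: "class_matrix G C $ x $ y = (if y \<otimes> inv x \<in> C then 1 else 0)"
  by (simp add: class_matrix_def)

lemma transpose_class_matrix:
  "transpose (class_matrix G (conj_class x)) = class_matrix G (conj_class (inv x))"
proof -
  have "w \<otimes> inv y \<in> conj_class x \<longleftrightarrow> y \<otimes> inv w \<in> conj_class (inv x)" for y w
    using inv_mem_conj_class[of "y \<otimes> inv w" x] by (simp add: inv_mult_group)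
  then show ?thesis
    by (simp add: vec_eq_iff transpose_def class_matrix_nth)
qed

lemma class_matrix_one: "class_matrix G {\<one>} = mat 1"
proof -
  have "y \<otimes> inv x = \<one> \<longleftrightarrow> x = y" for x y
    by (metis UNIV_I carrier_UNIV inv_equality inv_inv r_inv)
  then show ?thesis
    by (simp add: vec_eq_iff class_matrix_nth mat_def)
qed

text \<open>The generators are permuted by transposition, as the inverses of the elements of a class form
  a class.\<close>

lemma transpose_in_T: "A \<in> T \<Longrightarrow> transpose A \<in> T"
proof (induction rule: T_induct)
  case (class_matrix x)
  show ?case
    unfolding transpose_class_matrix by (rule class_matrix_in_T)
next
  case (class_projection x)
  show ?case
    unfolding transpose_class_projection by (rule class_projection_in_T)
next
  case one
  show ?case
    by (simp add: T_one)
next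
  case zero
  have "transpose (0 :: complex^'g^'g) = 0"
    by (simp add: vec_eq_iff transpose_def)
  then show ?case
    using T_subspace cmat.subspace_0 by simp
next
  case (add A B)
  have "transpose (A + B) = transpose A + transpose B"
    by (simp add: vec_eq_iff transpose_def)
  then show ?case
    using T_subspace add cmat.subspace_add by simp
next
  case (scale c A)
  then show ?case
    using T_subspace cmat.subspace_scale by (simp add: transpose_cmat_scale)
next
  case (mult A B)
  then show ?case
    using T_mult by (simp add: matrix_transpose_mul)
qed

text \<open>A symmetric matrix that is a common eigenvector of the generators spans a two-sided ideal: the
  left multiplications suffice, because transposition turns them into the right ones.\<close>

lemma line_two_sided_ideal:
  assumes z: "z \<in> T" "transpose z = z"
    and A: "\<And>x. class_matrix G (conj_class x) ** z \<in> cmat.span {z}"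
    and E: "\<And>x. class_projection (conj_class x) ** z \<in> cmat.span {z}"
  shows "two_sided_ideal T (cmat.span {z})"
proof -
  have left: "B ** z \<in> cmat.span {z}" if "B \<in> T" for B
    using that
  proof (induction rule: T_induct)
    case (add B C)
    then show ?case
      by (simp add: matrix_mult_add_left cmat.span_add)
  next
    case (mult B C)
    then show ?case
      by (auto simp: cmat_span_singleton matrix_mul_assoc[symmetric] cmat.scale_scale)
  qed (auto simp: A E cmat.span_base cmat.span_zero intro: cmat.span_scale)
  have right: "z ** B \<in> cmat.span {z}" if B: "B \<in> T" for B
  proof -
    obtain c where "transpose B ** z = cmat_scale c z"
      using left[OF transpose_in_T[OF B]] unfolding cmat_span_singleton by blast
    then have "transpose (transpose B ** z) = transpose (cmat_scale c z)"
      by simp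
    then have "z ** B = cmat_scale c z"
      by (simp add: matrix_transpose_mul transpose_cmat_scale z(2))
    then show ?thesis
      unfolding cmat_span_singleton by (rule range_eqI)
  qed
  have "cmat.span {z} \<subseteq> T"
    using cmat.span_minimal[OF _ T_subspace] z(1) by blast
  moreover have "B ** X \<in> cmat.span {z} \<and> X ** B \<in> cmat.span {z}" if B: "B \<in> T" and X: "X \<in> cmat.span {z}" for B X
  proof -
    obtain c where "X = cmat_scale c z"
      using X unfolding cmat_span_singleton by blast
    then show ?thesis
      using left[OF B] right[OF B] by (simp add: cmat.span_scale)
  qed
  ultimately show ?thesis
    unfolding two_sided_ideal_def by simp
qed

text \<open>\<open>T\<close> is contained in the centralizer algebra of the action of \<open>G\<close> on itself by
  conjugation.\<close>

lemma T_conj_invariant: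
  "A \<in> T \<Longrightarrow> A $ (g \<otimes> x \<otimes> inv g) $ (g \<otimes> y \<otimes> inv g) = A $ x $ y"
proof (induction arbitrary: x y rule: T_induct)
  case (class_matrix z)
  have "(g \<otimes> y \<otimes> inv g) \<otimes> inv (g \<otimes> x \<otimes> inv g) = g \<otimes> (y \<otimes> inv x) \<otimes> inv g"
    by (simp only: conj_inv conj_mult)
  then show ?case
    by (simp add: class_matrix_nth conj_mem_conj_class)
next
  case (class_projection z)
  have "g \<otimes> x \<otimes> inv g = g \<otimes> y \<otimes> inv g \<longleftrightarrow> x = y"
    by (metis inv_conj_conj(1))
  then show ?case
    by (simp add: class_projection_def conj_mem_conj_class)
next
  case one
  have "g \<otimes> x \<otimes> inv g = g \<otimes> y \<otimes> inv g \<longleftrightarrow> x = y"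
    by (metis inv_conj_conj(1))
  then show ?case
    by (simp add: mat_def)
next
  case (mult A B)
  have "(\<Sum>k\<in>UNIV. A $ (g \<otimes> x \<otimes> inv g) $ k * B $ k $ (g \<otimes> y \<otimes> inv g)) = (\<Sum>k\<in>UNIV. A $ x $ k * B $ k $ y)"
  proof (rule sum.reindex_bij_witness[of _ "\<lambda>k. g \<otimes> k \<otimes> inv g" "\<lambda>k. inv g \<otimes> k \<otimes> g"])
    fix k
    show "A $ x $ (inv g \<otimes> k \<otimes> g) * B $ (inv g \<otimes> k \<otimes> g) $ y =
        A $ (g \<otimes> x \<otimes> inv g) $ k * B $ k $ (g \<otimes> y \<otimes> inv g)"
      using mult.IH(1)[of x "inv g \<otimes> k \<otimes> g"] mult.IH(2)[of "inv g \<otimes> k \<otimes> g" y] by simp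
  qed auto
  then show ?case
    by (simp add: matrix_mult_nth)
qed auto

text \<open>This space is the primary component. The members of the centralizer algebra only need to be
  constant on the orbits of pairs, which refine the products of two classes.\<close>

definition class_blocks :: "(complex^'g^'g) set" where
  "class_blocks = {M. \<forall>x y. \<forall>x' \<in> conj_class x. \<forall>y' \<in> conj_class y. M $ x' $ y' = M $ x $ y}"

lemma class_blocksI:
  assumes "\<And>g x y. M $ (g \<otimes> x \<otimes> inv g) $ y = M $ x $ y" "\<And>g x y. M $ x $ (g \<otimes> y \<otimes> inv g) = M $ x $ y"
  shows "M \<in> class_blocks"
  using assms by (auto simp: class_blocks_def mem_conj_class)

lemma class_blocks_nth:
  "M \<in> class_blocks \<Longrightarrow> x' \<in> conj_class x \<Longrightarrow> y' \<in> conj_class y \<Longrightarrow> M $ x' $ y' = M $ x $ y"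
  by (auto simp: class_blocks_def)

lemma class_blocks_conj:
  assumes "M \<in> class_blocks"
  shows "M $ (g \<otimes> x \<otimes> inv g) $ y = M $ x $ y" "M $ x $ (g \<otimes> y \<otimes> inv g) = M $ x $ y"
  by (rule class_blocks_nth[OF assms]; simp add: conj_mem_conj_class)+

lemma subspace_class_blocks: "cmat.subspace class_blocks"
  by (auto simp: cmat.subspace_def class_blocks_def)

lemma transpose_class_blocks: "M \<in> class_blocks \<Longrightarrow> transpose M \<in> class_blocks"
  by (auto simp: class_blocks_def transpose_def)

lemma mult_class_blocks:
  assumes A: "A \<in> T" and M: "M \<in> class_blocks"
  shows "A ** M \<in> class_blocks"
proof (rule class_blocksI)
  fix g x y
  have "(\<Sum>k\<in>UNIV. A $ (g \<otimes> x \<otimes> inv g) $ k * M $ k $ y) = (\<Sum>k\<in>UNIV. A $ x $ k * M $ k $ y)"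
  proof (rule sum.reindex_bij_witness[of _ "\<lambda>k. g \<otimes> k \<otimes> inv g" "\<lambda>k. inv g \<otimes> k \<otimes> g"])
    fix k
    have "A $ x $ (inv g \<otimes> k \<otimes> g) = A $ (g \<otimes> x \<otimes> inv g) $ k"
      using T_conj_invariant[OF A, of g x "inv g \<otimes> k \<otimes> g"] by simp
    moreover have "M $ (inv g \<otimes> k \<otimes> g) $ y = M $ k $ y"
      using class_blocks_conj(1)[OF M, of "inv g"] by simp
    ultimately show "A $ x $ (inv g \<otimes> k \<otimes> g) * M $ (inv g \<otimes> k \<otimes> g) $ y = A $ (g \<otimes> x \<otimes> inv g) $ k * M $ k $ y"
      by simp
  qed auto
  then show "(A ** M) $ (g \<otimes> x \<otimes> inv g) $ y = (A ** M) $ x $ y"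
    by (simp add: matrix_mult_nth)
  show "(A ** M) $ x $ (g \<otimes> y \<otimes> inv g) = (A ** M) $ x $ y"
    by (simp add: matrix_mult_nth class_blocks_conj(2)[OF M])
qed

definition block_ones :: "'g \<Rightarrow> 'g \<Rightarrow> complex^'g^'g" where
  "block_ones u v = (\<chi> x y. if x \<in> conj_class u \<and> y \<in> conj_class v then 1 else 0)"

lemma sum_if_mem_class:
  "(\<Sum>C\<in>range conj_class. if x \<in> C then f C else 0) = (f (conj_class x) :: 'b::comm_monoid_add)"
proof -
  have "x \<in> C \<longleftrightarrow> C = conj_class x" if "C \<in> range conj_class" for C
    using that conj_class_eq by auto
  then have "(\<Sum>C\<in>range conj_class. if x \<in> C then f C else 0) =
      (\<Sum>C\<in>range conj_class. if C = conj_class x then f C else 0)"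
    by (intro sum.cong) auto
  then show ?thesis
    by simp
qed

lemma block_ones_in_T: "block_ones u v \<in> T"
proof -
  have "(\<Sum>C\<in>range conj_class. class_matrix G C) $ x $ y = 1" for x y
    by (simp add: class_matrix_nth sum_if_mem_class)
  then have "block_ones u v =
      class_projection (conj_class u) ** (\<Sum>C\<in>range conj_class. class_matrix G C) ** class_projection (conj_class v)"
    by (simp add: vec_eq_iff block_ones_def class_projection_mult_nth mult_class_projection_nth)
  moreover have "(\<Sum>C\<in>range conj_class. class_matrix G C) \<in> T"
    using T_subspace class_matrix_in_T by (intro cmat.subspace_sum) auto
  ultimately show ?thesis
    using T_mult class_projection_in_T by simp
qed

text \<open>Every class pair \<open>C \<times> D\<close> occurs \<open>|C| |D|\<close> times in the sum, hence the
  denominators.\<close>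

lemma class_blocks_expand:
  assumes M: "M \<in> class_blocks"
  shows "M = (\<Sum>u\<in>UNIV. \<Sum>v\<in>UNIV.
    cmat_scale (M $ u $ v / (of_nat (card (conj_class u)) * of_nat (card (conj_class v)))) (block_ones u v))"
proof -
  have "(\<Sum>u\<in>UNIV. \<Sum>v\<in>UNIV.
      M $ u $ v / (of_nat (card (conj_class u)) * of_nat (card (conj_class v))) * block_ones u v $ x $ y) = M $ x $ y" for x y
  proof -
    let ?c = "M $ x $ y / (of_nat (card (conj_class x)) * of_nat (card (conj_class y)))"
    have "(\<Sum>u\<in>UNIV. \<Sum>v\<in>UNIV.
        M $ u $ v / (of_nat (card (conj_class u)) * of_nat (card (conj_class v))) * block_ones u v $ x $ y)
      = (\<Sum>u\<in>UNIV. \<Sum>v\<in>UNIV. if u \<in> conj_class x then if v \<in> conj_class y then ?c else 0 else 0)"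
      using blocks_sym[OF blocks_conj_class] class_blocks_nth[OF M] conj_class_eq
      by (intro sum.cong) (auto simp: block_ones_def)
    also have "\<dots> = (\<Sum>u\<in>conj_class x. \<Sum>v\<in>conj_class y. ?c)"
      by (simp add: sum.If_cases if_distrib[of "sum _"] flip: sum.inter_restrict)
    also have "\<dots> = M $ x $ y"
      by simp
    finally show ?thesis .
  qed
  then show ?thesis
    by (simp add: vec_eq_iff)
qed

lemma class_blocks_subset:
  assumes "cmat.subspace S" "\<And>u v. block_ones u v \<in> S"
  shows "class_blocks \<subseteq> S"
proof
  fix M assume "M \<in> class_blocks"
  then show "M \<in> S"
    using assms by (subst class_blocks_expand)
      (auto intro!: cmat.subspace_sum cmat.subspace_scale)
qed

lemma class_blocks_ideal: "two_sided_ideal T class_blocks"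
proof -
  have "M ** A \<in> class_blocks" if "A \<in> T" "M \<in> class_blocks" for A M
  proof -
    have "transpose (transpose A ** transpose M) \<in> class_blocks"
      using that by (intro transpose_class_blocks mult_class_blocks transpose_in_T)
    then show ?thesis
      by (simp add: matrix_transpose_mul)
  qed
  then show ?thesis
    unfolding two_sided_ideal_def
    using class_blocks_subset[OF T_subspace block_ones_in_T] subspace_class_blocks mult_class_blocks
    by blast
qed

text \<open>The ideal is a full matrix algebra whose matrix units are the normalized blocks of ones: a single
  nonzero entry yields all of them by multiplication with blocks on both sides.\<close>

theorem class_blocks_minimal: "minimal_two_sided_ideal T class_blocks"
  unfolding minimal_two_sided_ideal_def
proof (intro conjI allI impI)
  have "block_ones \<one> \<one> \<in> class_blocks"
    by (rule class_blocksI) (simp_all add: block_ones_def conj_mem_conj_class)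
  moreover have "block_ones \<one> \<one> $ \<one> $ \<one> = 1"
    by (simp add: block_ones_def)
  then have "block_ones \<one> \<one> \<noteq> 0"
    by (metis zero_index zero_neq_one)
  ultimately show "class_blocks \<noteq> {0}"
    by blast
  fix J assume J: "two_sided_ideal T J \<and> J \<subseteq> class_blocks"
  note idealJ = two_sided_idealD[OF conjunct1[OF J]]
  show "J = {0} \<or> J = class_blocks"
  proof (cases "J = {0}")
    case False
    then obtain M where M: "M \<in> J" "M \<noteq> 0"
      using cmat.subspace_0[OF idealJ(2)] by blast
    then obtain x y where xy: "M $ x $ y \<noteq> 0"
      by (auto simp: vec_eq_iff)
    have "block_ones u v \<in> J" for u v
    proof -
      let ?c = "of_nat (card (conj_class x)) * M $ x $ y * of_nat (card (conj_class y))"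
      have c: "?c \<noteq> 0"
        using xy by simp
      have left: "(block_ones u x ** M) $ a $ b =
          (if a \<in> conj_class u then of_nat (card (conj_class x)) * M $ x $ b else 0)" for a b
      proof -
        have "(block_ones u x ** M) $ a $ b =
            (\<Sum>k\<in>UNIV. if k \<in> conj_class x then if a \<in> conj_class u then M $ x $ b else 0 else 0)"
          unfolding matrix_mult_nth using J M class_blocks_nth[of M _ x b b]
          by (intro sum.cong) (auto simp: block_ones_def)
        then show ?thesis
          by (simp add: sum.If_cases)
      qed
      have "(block_ones u x ** M ** block_ones y v) $ a $ b = ?c * block_ones u v $ a $ b" for a b
      proof -
        have "(block_ones u x ** M ** block_ones y v) $ a $ b =
          (\<Sum>k\<in>UNIV. if k \<in> conj_class y then
            if a \<in> conj_class u \<and> b \<in> conj_class v then of_nat (card (conj_class x)) * M $ x $ y else 0 else 0)"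
          unfolding matrix_mult_nth[of _ "block_ones y v"] left
          using J M class_blocks_nth[of M x x _ y]
          by (intro sum.cong) (auto simp: block_ones_def)
        then show ?thesis
          by (simp add: sum.If_cases block_ones_def)
      qed
      then have "block_ones u v = cmat_scale (1 / ?c) (block_ones u x ** M ** block_ones y v)"
        using c by (simp add: vec_eq_iff)
      moreover have "block_ones u x ** M ** block_ones y v \<in> J"
        using idealJ(3,4) M(1) block_ones_in_T by blast
      ultimately show ?thesis
        using cmat.subspace_scale[OF idealJ(2)] by metis
    qed
    then have "class_blocks \<subseteq> J"
      by (rule class_blocks_subset[OF idealJ(2)])
    then show ?thesis
      using J by blast
  qed simp
qed (use class_blocks_ideal in blast)

lemma averaging_conj_class: "averaging conj_class \<in> class_blocks"
  by (rule class_blocksI) (simp_all add: averaging_nth conj_mem_conj_class conj_class_conj)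

lemma averaging_conj_class_in_T: "averaging conj_class \<in> T"
  using averaging_conj_class two_sided_idealD(1)[OF class_blocks_ideal] by blast

lemma axis_in_primary_module: "axis \<one> 1 \<in> primary_module G"
proof -
  have "class_matrix G {\<one>} \<in> cmat.span (class_matrix G ` conjugacy_classes G)"
    unfolding conjugacy_classes_eq using conj_class_one by (metis cmat.span_base imageI rangeI)
  moreover have "axis \<one> 1 = class_matrix G {\<one>} *v (axis \<one> 1 :: complex^'g)"
    by (simp add: class_matrix_one)
  ultimately show ?thesis
    unfolding primary_module_def by blast
qed

lemma primary_module_subset: "primary_module G \<subseteq> (\<lambda>A. A *v axis \<one> 1) ` T"
proof -
  have "cmat.span (class_matrix G ` conjugacy_classes G) \<subseteq> T"
    using class_matrix_in_T unfolding conjugacy_classes_eq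
    by (intro cmat.span_minimal T_subspace) auto
  then show ?thesis
    unfolding primary_module_def by blast
qed

lemma matrix_vector_axis: "(A *v axis j 1) $ i = (A :: complex^'n^'n) $ i $ j"
  by (simp add: matrix_vector_mult_def axis_def if_distrib[of "(*) _"] cong: if_cong)

lemma class_blocks_acts: "acts_nontrivially class_blocks (primary_module G)"
proof -
  have "(averaging conj_class *v axis \<one> (1::complex)) $ \<one> \<noteq> 0"
    unfolding matrix_vector_axis by (simp add: averaging_nth conj_class_one)
  then have "averaging conj_class *v axis \<one> (1::complex) \<noteq> 0"
    by auto
  then show ?thesis
    unfolding acts_nontrivially_def using averaging_conj_class axis_in_primary_module by blast
qed

text \<open>The primary module is cyclic, generated by the basis vector of the base point. An ideal that
  annihilates this vector therefore annihilates the module.\<close>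

lemma not_acts_nontrivially:
  assumes "two_sided_ideal T I" "\<And>x A. A \<in> I \<Longrightarrow> A $ x $ \<one> = 0"
  shows "\<not> acts_nontrivially I (primary_module G)"
proof
  assume "acts_nontrivially I (primary_module G)"
  then obtain A B where AB: "A \<in> I" "B \<in> T" "A *v (B *v axis \<one> 1) \<noteq> 0"
    using primary_module_subset unfolding acts_nontrivially_def by blast
  then have "A ** B \<in> I"
    using two_sided_idealD(4)[OF assms(1)] by blast
  then have "(A ** B) *v axis \<one> 1 = 0"
    using assms(2) by (simp add: vec_eq_iff matrix_vector_axis)
  then show False
    using AB by (simp add: matrix_vector_mul_assoc)
qed

end

section \<open>Groups whose classes are layers of a two-step chain or cosets of its top\<close>

text \<open>A shape of the classes from which all minimal ideals of \<open>T\<close> can be read off.\<close>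

locale layered_group = finite_group_type G for G :: "('g::finite) monoid" (structure) +
  fixes N M :: "'g set"
  assumes subgroup_N: "subgroup N G" and subgroup_M: "subgroup M G"
    and N_subset_M: "N \<subseteq> M" and card_M: "card M = 2 * card N" and card_N: "2 < card N"
    and class_in_N: "x \<in> N \<Longrightarrow> x \<noteq> \<one> \<Longrightarrow> conj_class x = N - {\<one>}"
    and class_in_M: "x \<in> M \<Longrightarrow> x \<notin> N \<Longrightarrow> conj_class x = M - N"
    and class_outside: "x \<notin> M \<Longrightarrow> conj_class x = M #> x"
begin

lemma coset_N_subset_M: "N #> x \<subseteq> M #> x"
  using N_subset_M by (auto simp: r_coset_def)

lemma one_in_N: "\<one> \<in> N"
  by (rule subgroup.one_closed[OF subgroup_N])

lemma coset_N_in_M: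
  assumes "x \<in> M" "x \<notin> N"
  shows "N #> x = M - N"
proof (rule card_subset_eq)
  have "N #> x \<subseteq> M"
    using coset_N_subset_M assms(1) coset_eq_iff[OF subgroup_M] by metis
  moreover have "(N #> x) \<inter> N = {}"
    using assms(2) coset_eq_iff[OF subgroup_N] blocks_coset[OF subgroup_N] unfolding blocks_def
    by (metis disjoint_iff)
  ultimately show "N #> x \<subseteq> M - N"
    by blast
  have "card (M - N) = card N"
    using card_M N_subset_M by (simp add: card_Diff_subset)
  then show "card (N #> x) = card (M - N)"
    by (simp add: card_coset[OF subgroup_N])
qed simp

lemma conj_class_subset_coset: "conj_class x \<subseteq> M #> x"
proof (cases "x \<in> M")
  case True
  then have "conj_class x \<subseteq> M"
    using class_in_N class_in_M conj_class_one N_subset_M one_in_N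
    by (cases "x = \<one>"; cases "x \<in> N") auto
  then show ?thesis
    using True coset_self[OF subgroup_M] by simp
qed (simp add: class_outside)

lemma conj_class_subset_M: "x \<in> M \<Longrightarrow> conj_class x \<subseteq> M"
  using conj_class_subset_coset[of x] coset_self[OF subgroup_M] by simp

text \<open>This partition lies between the one into points and the one into classes. It agrees with the
  latter on \<open>M\<close> and consists of the cosets of \<open>N\<close> outside.\<close>

definition inner_block :: "'g \<Rightarrow> 'g set" where
  "inner_block x = conj_class x \<inter> (N #> x)"

lemma blocks_inner_block: "blocks inner_block"
  using blocks_conj_class blocks_coset[OF subgroup_N] unfolding blocks_def inner_block_def by blast

lemma inner_block_in_M:
  assumes "x \<in> M"
  shows "inner_block x = conj_class x"
proof -
  have "conj_class x \<subseteq> N #> x"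
  proof (cases "x \<in> N")
    case True
    then have "N #> x = N"
      using coset_eq_iff[OF subgroup_N] by simp
    then show ?thesis
      using True class_in_N conj_class_one by (cases "x = \<one>") auto
  qed (simp add: assms class_in_M coset_N_in_M)
  then show ?thesis
    by (auto simp: inner_block_def)
qed

lemma inner_block_outside: "x \<notin> M \<Longrightarrow> inner_block x = N #> x"
  using coset_N_subset_M by (auto simp: inner_block_def class_outside)

lemma inner_block_subset: "inner_block x \<subseteq> N #> x" "inner_block x \<subseteq> conj_class x"
  by (auto simp: inner_block_def)

lemma card_inner_block:
  assumes "x \<noteq> \<one>"
  shows "1 < card (inner_block x)"
proof -
  consider "x \<in> N" | "x \<in> M" "x \<notin> N" | "x \<notin> M"
    by blast
  then show ?thesis
  proof cases
    case 1
    then have "inner_block x = N - {\<one>}"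
      using assms N_subset_M inner_block_in_M class_in_N by auto
    then show ?thesis
      using card_N one_in_N by simp
  next
    case 2
    then have "inner_block x = N #> x"
      by (simp add: inner_block_in_M class_in_M coset_N_in_M)
    then show ?thesis
      using card_N by (simp add: card_coset[OF subgroup_N])
  next
    case 3
    then show ?thesis
      using card_N by (simp add: inner_block_outside card_coset[OF subgroup_N])
  qed
qed

text \<open>The two parts are the orthogonal projections to the vectors with sum zero on every inner block,
  and to the vectors with sum zero on every class that are constant on the inner blocks. With the
  projection to the vectors constant on the classes, they add up to the unit matrix.\<close>

definition fine_part :: "complex^'g^'g" where
  "fine_part = mat 1 - averaging inner_block"

definition coarse_part :: "complex^'g^'g" where
  "coarse_part = averaging inner_block - averaging conj_class"

text \<open>Inside \<open>M\<close> the inner blocks are the classes and nothing is left. Outside, the two partitions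
  are those into the cosets of \<open>N\<close> and of \<open>M\<close>, which shows that the coarse part lies in \<open>T\<close>.\<close>

lemma coarse_eq:
  "coarse_part = (averaging (\<lambda>x. N #> x) - averaging (\<lambda>x. M #> x)) ** class_projection (- M)"
proof -
  have "coarse_part $ x $ y =
      (if y \<in> - M then averaging (\<lambda>x. N #> x) $ x $ y - averaging (\<lambda>x. M #> x) $ x $ y else 0)" for x y
  proof (cases "x \<in> M")
    case True
    then have "y \<notin> M #> x" "y \<notin> N #> x" if "y \<notin> M"
      using that coset_eq_iff[OF subgroup_M] coset_N_subset_M by blast+
    then show ?thesis
      using True by (auto simp: coarse_part_def averaging_nth inner_block_in_M)
  next
    case False
    then have "y \<notin> M #> x" "y \<notin> N #> x" if "y \<in> M"
      using that coset_eq_iff[OF subgroup_M] coset_N_subset_M blocks_coset[OF subgroup_M]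
      unfolding blocks_def by (metis subsetD)+
    then show ?thesis
      using False by (auto simp: coarse_part_def averaging_nth inner_block_outside class_outside)
  qed
  then show ?thesis
    by (simp add: vec_eq_iff mult_class_projection_nth)
qed

lemma class_matrix_subgroup:
  assumes "subgroup S G"
  shows "class_matrix G S = cmat_scale (of_nat (card S)) (averaging (\<lambda>x. S #> x))"
proof -
  have "card S \<noteq> 0"
    using subgroup.one_closed[OF assms] by (auto simp: card_eq_0_iff)
  then show ?thesis
    by (simp add: vec_eq_iff class_matrix_nth averaging_nth mem_coset card_coset[OF assms])
qed

text \<open>If \<open>D\<close> is a union of cosets of \<open>S\<close>, then entry \<open>(x, y)\<close> of the matrix of \<open>D\<close> depends only
  on the coset of \<open>y\<close>, so averaging over parts of these cosets changes nothing.\<close>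

lemma class_matrix_absorb:
  assumes S: "subgroup S G" and D: "\<And>d. d \<in> D \<Longrightarrow> S #> d \<subseteq> D"
    and B: "blocks B" "\<And>x. B x \<subseteq> S #> x"
  shows "class_matrix G D ** averaging B = class_matrix G D"
proof (rule mult_averaging_right[OF B(1)])
  fix x y w assume "w \<in> B y"
  then have "w \<otimes> inv y \<in> S"
    using B(2) mem_coset by blast
  moreover have "(w \<otimes> inv x) \<otimes> inv (y \<otimes> inv x) = w \<otimes> inv y"
    by (simp add: inv_mult_group m_assoc) (metis UNIV_I carrier_UNIV inv_solve_left' l_inv m_assoc r_one inv_closed m_closed)
  ultimately have w: "w \<otimes> inv x \<in> S #> (y \<otimes> inv x)"
    using mem_coset by simp
  then have "S #> (w \<otimes> inv x) = S #> (y \<otimes> inv x)" "y \<otimes> inv x \<in> S #> (w \<otimes> inv x)"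
    using blocks_coset[OF S] unfolding blocks_def by blast+
  then have "w \<otimes> inv x \<in> D \<longleftrightarrow> y \<otimes> inv x \<in> D"
    using w D by blast
  then show "class_matrix G D $ x $ w = class_matrix G D $ x $ y"
    by (simp add: class_matrix_nth)
qed

lemma coset_closed:
  "d \<in> N \<Longrightarrow> N #> d \<subseteq> N" "d \<in> M \<Longrightarrow> M #> d \<subseteq> M" "d \<in> M #> x \<Longrightarrow> M #> d \<subseteq> M #> x"
  "d \<in> M \<Longrightarrow> N #> d \<subseteq> M" "d \<in> M #> x \<Longrightarrow> N #> d \<subseteq> M #> x"
proof -
  show "d \<in> N \<Longrightarrow> N #> d \<subseteq> N" and M: "d \<in> M \<Longrightarrow> M #> d \<subseteq> M"
    using coset_eq_iff[OF subgroup_N] coset_eq_iff[OF subgroup_M] by blast+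
  show M': "d \<in> M #> x \<Longrightarrow> M #> d \<subseteq> M #> x"
    using blocks_coset[OF subgroup_M] unfolding blocks_def by blast
  show "d \<in> M \<Longrightarrow> N #> d \<subseteq> M" "d \<in> M #> x \<Longrightarrow> N #> d \<subseteq> M #> x"
    using M M' coset_N_subset_M[of d] by blast+
qed

lemma class_matrix_cases:
  obtains "class_matrix G (conj_class x) = mat 1"
  | "class_matrix G (conj_class x) = class_matrix G N - mat 1"
  | "class_matrix G (conj_class x) = class_matrix G M - class_matrix G N"
  | "class_matrix G (conj_class x) = class_matrix G (M #> x)"
proof -
  have diff: "class_matrix G (D - D') = class_matrix G D - class_matrix G D'" if "D' \<subseteq> D" for D D'
    using that by (auto simp: vec_eq_iff class_matrix_nth)
  consider "x = \<one>" | "x \<in> N" "x \<noteq> \<one>" | "x \<in> M" "x \<notin> N" | "x \<notin> M"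
    by blast
  then show ?thesis
    using that diff[of "{\<one>}" N] diff[of N M] class_in_N class_in_M class_outside conj_class_one
      class_matrix_one one_in_N N_subset_M
    by cases simp_all
qed

text \<open>All classes but \<open>{\<one>}\<close> and \<open>N - {\<one>}\<close> are unions of cosets of \<open>N\<close>, and the matrices of
  such unions annihilate a vector with sum zero on every inner block. The matrix of \<open>{\<one>}\<close> is the
  unit, and adding it to the matrix of \<open>N - {\<one>}\<close> gives the one of \<open>N\<close>, so the eigenvalues are
  \<open>1\<close>, \<open>-1\<close> and \<open>0\<close>.\<close>

lemma fine_eigen: "\<exists>c. class_matrix G (conj_class x) ** fine_part = cmat_scale c fine_part"
proof -
  have absorb: "class_matrix G D ** fine_part = 0" if "\<And>d. d \<in> D \<Longrightarrow> N #> d \<subseteq> D" for D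
    using class_matrix_absorb[OF subgroup_N that blocks_inner_block inner_block_subset(1)]
    by (simp add: fine_part_def matrix_mult_diff_right)
  have [simp]: "class_matrix G N ** fine_part = 0" "class_matrix G M ** fine_part = 0"
    "class_matrix G (M #> y) ** fine_part = 0" for y
    by (intro absorb coset_closed; assumption)+
  show ?thesis
  proof (rule class_matrix_cases[of x])
    assume "class_matrix G (conj_class x) = mat 1"
    then show ?thesis
      by (intro exI[of _ 1]) simp
  next
    assume "class_matrix G (conj_class x) = class_matrix G N - mat 1"
    then show ?thesis
      by (intro exI[of _ "-1"]) (simp add: matrix_mult_diff_left)
  next
    assume "class_matrix G (conj_class x) = class_matrix G M - class_matrix G N"
    then show ?thesis
      by (intro exI[of _ 0]) (simp add: matrix_mult_diff_left)
  next
    assume "class_matrix G (conj_class x) = class_matrix G (M #> x)"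
    then show ?thesis
      by (intro exI[of _ 0]) simp
  qed
qed

text \<open>The matrices of unions of cosets of \<open>M\<close> annihilate the coarse part, whose columns have sum
  zero on these cosets. What is left are \<open>M - N\<close> and the classes inside \<open>N\<close>, so it remains to see that
  the matrix of \<open>N\<close> acts as \<open>|N|\<close>: the coarse part has columns that are constant on the cosets
  of \<open>N\<close>.\<close>

lemma coarse_eigen: "\<exists>c. class_matrix G (conj_class x) ** coarse_part = cmat_scale c coarse_part"
proof -
  have absorb: "class_matrix G D ** coarse_part = 0" if "\<And>d. d \<in> D \<Longrightarrow> M #> d \<subseteq> D" for D
  proof -
    have "inner_block y \<subseteq> M #> y" for y
      using inner_block_subset(1) coset_N_subset_M by blast
    then show ?thesis
      using class_matrix_absorb[OF subgroup_M that blocks_inner_block]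
        class_matrix_absorb[OF subgroup_M that blocks_conj_class conj_class_subset_coset]
      by (simp add: coarse_part_def matrix_mult_diff_right)
  qed
  have [simp]: "class_matrix G M ** coarse_part = 0" "class_matrix G (M #> y) ** coarse_part = 0" for y
    by (intro absorb coset_closed; assumption)+
  have "averaging (\<lambda>x. N #> x) ** coarse_part = coarse_part"
    unfolding coarse_eq matrix_mul_assoc matrix_mult_diff_right
    using averaging_refine[OF blocks_coset[OF subgroup_N] blocks_coset[OF subgroup_M] coset_N_subset_M]
      averaging_refine[OF blocks_coset[OF subgroup_N] blocks_coset[OF subgroup_N]] by simp
  then have [simp]: "class_matrix G N ** coarse_part = cmat_scale (of_nat (card N)) coarse_part"
    by (simp add: class_matrix_subgroup[OF subgroup_N])
  show ?thesis
  proof (rule class_matrix_cases[of x])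
    assume "class_matrix G (conj_class x) = mat 1"
    then show ?thesis
      by (intro exI[of _ 1]) simp
  next
    assume "class_matrix G (conj_class x) = class_matrix G N - mat 1"
    then show ?thesis
      by (intro exI[of _ "of_nat (card N) - 1"])
        (simp add: matrix_mult_diff_left, simp add: vec_eq_iff left_diff_distrib)
  next
    assume "class_matrix G (conj_class x) = class_matrix G M - class_matrix G N"
    then show ?thesis
      by (intro exI[of _ "- of_nat (card N)"]) (simp add: matrix_mult_diff_left)
  next
    assume "class_matrix G (conj_class x) = class_matrix G (M #> x)"
    then show ?thesis
      by (intro exI[of _ 0]) simp
  qed
qed

lemma nontrivial_in_N: obtains x where "x \<in> N" "x \<noteq> \<one>"
proof -
  have "\<not> N \<subseteq> {\<one>}"
    using card_N card_mono[of "{\<one>}" N] by force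
  then show thesis
    using that by blast
qed

lemma M_minus_N_nonempty: obtains y where "y \<in> M" "y \<notin> N"
proof -
  have "\<not> M \<subseteq> N"
    using card_M card_N card_mono[of N M] by force
  then show thesis
    using that by blast
qed

lemma T_diff: "A \<in> T \<Longrightarrow> B \<in> T \<Longrightarrow> A - B \<in> T"
  by (rule cmat.subspace_diff[OF T_subspace])

lemma T_add: "A \<in> T \<Longrightarrow> B \<in> T \<Longrightarrow> A + B \<in> T"
  by (rule cmat.subspace_add[OF T_subspace])

lemma class_matrix_N_in_T: "class_matrix G N \<in> T"
proof -
  obtain x where x: "x \<in> N" "x \<noteq> \<one>"
    by (rule nontrivial_in_N)
  have "class_matrix G N = class_matrix G (N - {\<one>}) + class_matrix G {\<one>}"
    using one_in_N by (auto simp: vec_eq_iff class_matrix_nth)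
  also have "\<dots> = class_matrix G (conj_class x) + class_matrix G (conj_class \<one>)"
    by (simp only: class_in_N[OF x] conj_class_one)
  finally show ?thesis
    by (simp only: T_add class_matrix_in_T)
qed

lemma class_matrix_M_in_T: "class_matrix G M \<in> T"
proof -
  obtain y where y: "y \<in> M" "y \<notin> N"
    by (rule M_minus_N_nonempty)
  have "class_matrix G M = class_matrix G (M - N) + class_matrix G N"
    using N_subset_M by (auto simp: vec_eq_iff class_matrix_nth)
  also have "\<dots> = class_matrix G (conj_class y) + class_matrix G N"
    by (simp only: class_in_M[OF y])
  finally show ?thesis
    by (simp only: T_add class_matrix_in_T class_matrix_N_in_T)
qed

lemma class_projection_outside_in_T: "class_projection (- M) \<in> T"
proof -
  obtain x where x: "x \<in> N" "x \<noteq> \<one>"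
    by (rule nontrivial_in_N)
  obtain y where y: "y \<in> M" "y \<notin> N"
    by (rule M_minus_N_nonempty)
  have diff: "class_projection (D - D') = class_projection D - class_projection D'" if "D' \<subseteq> D" for D D' :: "'g set"
    using that by (auto simp: vec_eq_iff class_projection_def)
  have "class_projection (- M) = class_projection (UNIV - N - (M - N))"
    using N_subset_M by (intro arg_cong[of _ _ class_projection]) blast
  also have "\<dots> = class_projection (UNIV - {\<one>} - (N - {\<one>})) - class_projection (M - N)"
    using one_in_N by (subst diff) (auto intro: arg_cong[of _ _ class_projection])
  also have "\<dots> = class_projection UNIV - class_projection {\<one>} - class_projection (N - {\<one>}) - class_projection (M - N)"
    by (subst diff, blast)+ (rule refl)
  also have "\<dots> = mat 1 - class_projection (conj_class \<one>) - class_projection (conj_class x) - class_projection (conj_class y)"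
    by (simp add: class_in_N[OF x] class_in_M[OF y] conj_class_one)
      (simp add: vec_eq_iff class_projection_def mat_def)
  finally show ?thesis
    by (simp only: T_diff T_one class_projection_in_T)
qed

lemma averaging_coset_in_T:
  assumes S: "subgroup S G" "class_matrix G S \<in> T"
  shows "averaging (\<lambda>x. S #> x) \<in> T"
proof -
  have "card S \<noteq> 0"
    using subgroup.one_closed[OF S(1)] by (auto simp: card_eq_0_iff)
  then have "averaging (\<lambda>x. S #> x) = cmat_scale (1 / of_nat (card S)) (class_matrix G S)"
    by (simp add: class_matrix_subgroup[OF S(1)] cmat.scale_scale)
  then show ?thesis
    using cmat.subspace_scale[OF T_subspace S(2)] by simp
qed

lemma coarse_in_T: "coarse_part \<in> T"
  unfolding coarse_eq
  by (intro T_mult T_diff averaging_coset_in_T subgroup_N subgroup_M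
      class_matrix_N_in_T class_matrix_M_in_T class_projection_outside_in_T)

lemma fine_in_T: "fine_part \<in> T"
proof -
  have "fine_part = mat 1 - coarse_part - averaging conj_class"
    by (simp add: fine_part_def coarse_part_def)
  then show ?thesis
    by (simp only: T_diff T_one coarse_in_T averaging_conj_class_in_T)
qed

lemma transpose_fine: "transpose fine_part = fine_part" and transpose_coarse: "transpose coarse_part = coarse_part"
  by (simp_all add: fine_part_def coarse_part_def transpose_diff transpose_averaging blocks_inner_block blocks_conj_class)

lemma
  shows fine_commutes: "class_projection (conj_class u) ** fine_part = fine_part ** class_projection (conj_class u)"
    and coarse_commutes: "class_projection (conj_class u) ** coarse_part = coarse_part ** class_projection (conj_class u)"
proof -
  have "inner_block x \<subseteq> conj_class u" "conj_class x \<subseteq> conj_class u" if "x \<in> conj_class u" for x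
    using conj_class_eq[OF that] by (auto simp: inner_block_def)
  then show "class_projection (conj_class u) ** fine_part = fine_part ** class_projection (conj_class u)"
    and "class_projection (conj_class u) ** coarse_part = coarse_part ** class_projection (conj_class u)"
    by (simp_all add: fine_part_def coarse_part_def matrix_mult_diff_left matrix_mult_diff_right
        class_projection_commutes_averaging blocks_inner_block blocks_conj_class)
qed

lemma averaging_inner_fine: "averaging inner_block ** fine_part = 0"
  and averaging_inner_coarse: "averaging inner_block ** coarse_part = coarse_part"
  using averaging_refine[OF blocks_inner_block blocks_inner_block]
    averaging_refine[OF blocks_inner_block blocks_conj_class inner_block_subset(2)]
  by (simp_all add: fine_part_def coarse_part_def matrix_mult_diff_right)

lemma fine_class_one: "fine_part ** class_projection {\<one>} = 0"
proof -
  have "fine_part $ x $ \<one> = 0" for x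
  proof -
    have "inner_block \<one> = {\<one>}"
      using inner_block_in_M N_subset_M one_in_N conj_class_one by auto
    then have "\<one> \<in> inner_block x \<longleftrightarrow> x = \<one>"
      using blocks_sym[OF blocks_inner_block] by blast
    then show ?thesis
      using \<open>inner_block \<one> = {\<one>}\<close> by (auto simp: fine_part_def averaging_nth mat_def)
  qed
  then show ?thesis
    by (simp add: vec_eq_iff mult_class_projection_nth)
qed

lemma coarse_class_in_M: "C \<subseteq> M \<Longrightarrow> coarse_part ** class_projection C = 0"
proof -
  assume "C \<subseteq> M"
  then have "- M \<inter> C = {}"
    by blast
  then show ?thesis
    by (simp add: coarse_eq matrix_mul_assoc[symmetric] class_projection_mult_class_projection
        class_projection_empty)
qed

subsection \<open>The one-dimensional ideals\<close>

text \<open>The pairs left out are exactly those whose product is zero: the class \<open>{\<one>}\<close> is a single point,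
  and every class inside \<open>M\<close> is a single inner block.\<close>

definition idem_index :: "((complex^'g^'g) \<times> 'g set) set" where
  "idem_index = {fine_part} \<times> (range conj_class - {{\<one>}}) \<union> {coarse_part} \<times> {C \<in> range conj_class. C \<inter> M = {}}"

definition idem :: "(complex^'g^'g) \<times> 'g set \<Rightarrow> complex^'g^'g" where
  "idem i = fst i ** class_projection (snd i)"

lemma idem_index_cases:
  assumes "i \<in> idem_index"
  obtains X u where "i = (X, conj_class u)" "X = fine_part \<or> X = coarse_part"
proof -
  have X: "fst i = fine_part \<or> fst i = coarse_part" and "snd i \<in> range conj_class"
    using assms unfolding idem_index_def by auto
  then obtain u where "snd i = conj_class u"
    by blast
  then have "i = (fst i, conj_class u)"
    by (simp add: prod_eq_iff)
  then show thesis
    using that X by blast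
qed

lemma idem_nonzero:
  assumes "i \<in> idem_index"
  shows "idem i \<noteq> 0"
proof -
  consider x where "i = (fine_part, conj_class x)" "x \<noteq> \<one>" | x where "i = (coarse_part, conj_class x)" "x \<notin> M"
    using assms conj_class_one unfolding idem_index_def
    by (auto simp: disjoint_iff)
  then obtain x where "idem i $ x $ x \<noteq> 0"
  proof cases
    case (1 x)
    have "fine_part $ x $ x \<noteq> 0"
      using card_inner_block[OF 1(2)] blocks_inner_block
      by (auto simp: fine_part_def mat_def averaging_nth blocks_def)
    then show thesis
      using that[of x] 1 by (simp add: idem_def mult_class_projection_nth)
  next
    case (2 x)
    have "coarse_part $ x $ x = 1 / of_nat (card N) - 1 / of_nat (card M)"
      using 2 blocks_coset[OF subgroup_N] blocks_coset[OF subgroup_M]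
      by (simp add: coarse_part_def averaging_nth inner_block_outside class_outside
          card_coset subgroup_N subgroup_M blocks_def)
    then have "coarse_part $ x $ x \<noteq> 0"
      using card_N by (auto simp: card_M field_simps)
    then show thesis
      using that[of x] 2 by (simp add: idem_def mult_class_projection_nth)
  qed
  then show ?thesis
    by auto
qed

lemma idem_ideal:
  assumes "i \<in> idem_index"
  shows "two_sided_ideal T (cmat.span {idem i})"
proof -
  obtain X u where i: "i = (X, conj_class u)" and X: "X = fine_part \<or> X = coarse_part"
    by (rule idem_index_cases[OF assms])
  let ?E = "\<lambda>v. class_projection (conj_class v)"
  have comm: "?E v ** X = X ** ?E v" for v
    using X fine_commutes coarse_commutes by blast
  show ?thesis
  proof (rule line_two_sided_ideal)
    show "idem i \<in> T"
      using X fine_in_T coarse_in_T T_mult class_projection_in_T by (auto simp: idem_def i)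
    show "transpose (idem i) = idem i"
      using X transpose_fine transpose_coarse comm
      by (auto simp: idem_def i matrix_transpose_mul transpose_class_projection)
    fix v
    obtain c where "class_matrix G (conj_class v) ** X = cmat_scale c X"
      using X fine_eigen coarse_eigen by blast
    then show "class_matrix G (conj_class v) ** idem i \<in> cmat.span {idem i}"
      by (simp add: idem_def i matrix_mul_assoc cmat.span_base cmat.span_scale)
    have "?E v ** idem i = X ** (?E v ** ?E u)"
      by (simp add: idem_def i matrix_mul_assoc comm)
    also have "\<dots> \<in> {idem i, 0}"
      using conj_class_disjoint[of v u]
      by (cases "conj_class v = conj_class u")
        (auto simp: idem_def i class_projection_mult_class_projection class_projection_empty)
    finally show "?E v ** idem i \<in> cmat.span {idem i}"
      by (auto simp: cmat.span_base cmat.span_zero)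
  qed
qed

lemma idem_not_acts:
  assumes i: "i \<in> idem_index"
  shows "\<not> acts_nontrivially (cmat.span {idem i}) (primary_module G)"
proof (rule not_acts_nontrivially[OF idem_ideal[OF i]])
  fix x A assume "A \<in> cmat.span {idem i}"
  then obtain c where "A = cmat_scale c (idem i)"
    unfolding cmat_span_singleton by blast
  moreover have "\<one> \<notin> snd i"
  proof
    assume one: "\<one> \<in> snd i"
    obtain u where "snd i = conj_class u"
      using idem_index_cases[OF i] by (metis snd_conv)
    then have "snd i = {\<one>}"
      using one conj_class_eq conj_class_one by simp
    then show False
      using i one_in_N N_subset_M unfolding idem_index_def by auto
  qed
  ultimately show "A $ x $ \<one> = 0"
    by (simp add: idem_def mult_class_projection_nth)
qed

lemma coarse_neq_fine:
  assumes "i \<in> idem_index" "fst i = coarse_part"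
  shows "fine_part \<noteq> coarse_part"
proof
  assume "fine_part = coarse_part"
  then have "coarse_part = 0"
    using averaging_inner_fine averaging_inner_coarse by simp
  then show False
    using idem_nonzero[OF assms(1)] assms(2) by (simp add: idem_def)
qed

text \<open>Both members of the pair can be read off the line: the class from the multiplication by the
  class projections, and the part from the averaging over the inner blocks, which kills the fine part
  and fixes the coarse one.\<close>

lemma inj_idem_line: "inj_on (\<lambda>i. cmat.span {idem i}) idem_index"
proof (rule inj_onI)
  fix i j assume i: "i \<in> idem_index" and j: "j \<in> idem_index"
    and eq: "cmat.span {idem i} = cmat.span {idem j}"
  have "idem i \<in> cmat.span {idem j}"
    using eq by (metis cmat.span_base insertI1)
  then obtain c where c: "idem i = cmat_scale c (idem j)"
    unfolding cmat_span_singleton by blast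
  obtain X u where iX: "i = (X, conj_class u)" "X = fine_part \<or> X = coarse_part"
    by (rule idem_index_cases[OF i])
  obtain Y v where jY: "j = (Y, conj_class v)" "Y = fine_part \<or> Y = coarse_part"
    by (rule idem_index_cases[OF j])
  note ij = iX(1) jY(1) and XY = iX(2) jY(2)
  have "conj_class u = conj_class v"
  proof (rule ccontr)
    assume "conj_class u \<noteq> conj_class v"
    then have "conj_class v \<inter> conj_class u = {}"
      using conj_class_disjoint by blast
    then have "idem j ** class_projection (conj_class u) = 0"
      by (simp add: idem_def ij matrix_mul_assoc[symmetric] class_projection_mult_class_projection
          class_projection_empty)
    moreover have "idem i ** class_projection (conj_class u) = idem i"
      by (simp add: idem_def ij matrix_mul_assoc[symmetric] class_projection_mult_class_projection)
    ultimately show False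
      using c idem_nonzero[OF i] by simp
  qed
  moreover have "X = Y"
  proof (rule ccontr)
    assume "X \<noteq> Y"
    let ?P = "averaging inner_block"
    have "?P ** idem i = (?P ** X) ** class_projection (conj_class u)"
      "?P ** idem j = (?P ** Y) ** class_projection (conj_class v)"
      by (simp_all add: idem_def ij matrix_mul_assoc)
    then have "idem i = 0 \<or> idem j = 0"
      using \<open>X \<noteq> Y\<close> XY c averaging_inner_fine averaging_inner_coarse
      by (auto simp: idem_def ij)
    then show False
      using idem_nonzero i j by blast
  qed
  ultimately show "i = j"
    by (simp add: ij)
qed

lemma finite_idem_index: "finite idem_index"
  by (simp add: idem_index_def)

lemma one_eq_sum: "mat 1 = averaging conj_class + (\<Sum>i\<in>idem_index. idem i)"
proof -
  have "(\<Sum>C\<in>range conj_class. class_projection C) $ x $ y = (mat 1 :: complex^'g^'g) $ x $ y" for x y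
  proof -
    have "(\<Sum>C\<in>range conj_class. class_projection C) $ x $ y =
        (\<Sum>C\<in>range conj_class. if y \<in> C then if x = y then 1 else (0 :: complex) else 0)"
      unfolding sum_component by (intro sum.cong) (auto simp: class_projection_def)
    then show ?thesis
      by (simp add: sum_if_mem_class mat_def)
  qed
  then have sum_proj: "(\<Sum>C\<in>range conj_class. class_projection C) = mat 1"
    by (simp add: vec_eq_iff)
  have expand: "X = (\<Sum>C\<in>range conj_class. X ** class_projection C)" for X
    by (simp flip: matrix_mult_sum_right add: sum_proj)
  have fine: "fine_part = (\<Sum>C\<in>range conj_class - {{\<one>}}. fine_part ** class_projection C)"
    by (subst expand) (rule sum.mono_neutral_right; auto simp: fine_class_one)
  have "C \<subseteq> M" if "C \<in> range conj_class" "C \<inter> M \<noteq> {}" for C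
    using that conj_class_subset_M conj_class_eq by blast
  then have coarse: "coarse_part = (\<Sum>C\<in>{C \<in> range conj_class. C \<inter> M = {}}. coarse_part ** class_projection C)"
    by (subst expand) (rule sum.mono_neutral_right; auto simp: coarse_class_in_M)
  have sum_idem: "(\<Sum>i\<in>{X} \<times> S. idem i) = (\<Sum>C\<in>S. X ** class_projection C)" for X S
    using sum.cartesian_product[of "\<lambda>X C. X ** class_projection C" S "{X}"]
    by (simp add: idem_def case_prod_unfold)
  have "(\<Sum>i\<in>idem_index. idem i) = (\<Sum>i\<in>{fine_part} \<times> (range conj_class - {{\<one>}}). idem i) +
      (\<Sum>i\<in>{coarse_part} \<times> {C \<in> range conj_class. C \<inter> M = {}}. idem i)"
    unfolding idem_index_def
  proof (rule sum.union_disjoint)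
    show "({fine_part} \<times> (range conj_class - {{\<one>}})) \<inter> ({coarse_part} \<times> {C \<in> range conj_class. C \<inter> M = {}}) = {}"
      using coarse_neq_fine unfolding idem_index_def by fastforce
  qed simp_all
  also have "\<dots> = fine_part + coarse_part"
    unfolding sum_idem using fine coarse by argo
  finally show ?thesis
    by (simp add: fine_part_def coarse_part_def)
qed

theorem wedderburn:
  "wedderburn_decomposition T (insert class_blocks ((\<lambda>i. cmat.span {idem i}) ` idem_index))"
  (is "wedderburn_decomposition T (insert class_blocks (?line ` idem_index))")
proof -
  have V: "class_blocks \<notin> ?line ` idem_index"
    using class_blocks_acts idem_not_acts by auto
  define e where "e I = (if I = class_blocks then averaging conj_class
    else idem (inv_into idem_index ?line I))" for I
  have e_line: "e (?line i) = idem i" if "i \<in> idem_index" for i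
    using that V inv_into_f_f[OF inj_idem_line that] unfolding e_def by auto
  show ?thesis
  proof (rule wedderburn_decompositionI[OF matrix_subalgebra_T])
    show "finite (insert class_blocks (?line ` idem_index))"
      by (simp add: finite_idem_index)
    fix I assume "I \<in> insert class_blocks (?line ` idem_index)"
    then consider "I = class_blocks" | i where "i \<in> idem_index" "I = ?line i"
      by blast
    then show "minimal_two_sided_ideal T I" "e I \<in> I"
    proof (atomize (full), cases)
      case 1
      then show "minimal_two_sided_ideal T I \<and> e I \<in> I"
        using class_blocks_minimal averaging_conj_class by (simp add: e_def)
    next
      case 2
      then show "minimal_two_sided_ideal T I \<and> e I \<in> I"
        using line_minimal_two_sided_ideal[OF idem_ideal idem_nonzero] e_line
        by (simp add: cmat.span_base)
    qed
  next
    have "(\<Sum>I\<in>?line ` idem_index. e I) = (\<Sum>i\<in>idem_index. idem i)"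
      by (simp add: sum.reindex[OF inj_idem_line] e_line)
    then show "mat 1 = (\<Sum>I\<in>insert class_blocks (?line ` idem_index). e I)"
      using V one_eq_sum by (simp add: finite_idem_index) (simp add: e_def)
  qed
qed

lemma primary_component_class_blocks: "is_primary_component G class_blocks"
proof -
  have "{I. minimal_two_sided_ideal T I} = insert class_blocks ((\<lambda>i. cmat.span {idem i}) ` idem_index)"
    using wedderburn unfolding wedderburn_decomposition_def by simp
  then have "minimal_two_sided_ideal T I \<longleftrightarrow> I = class_blocks \<or> (\<exists>i\<in>idem_index. I = cmat.span {idem i})" for I
    by (auto simp: set_eq_iff)
  then show ?thesis
    unfolding is_primary_component_def using class_blocks_acts idem_not_acts by metis
qed

text \<open>The classes besides \<open>{\<one>}\<close> are \<open>N - {\<one>}\<close>, \<open>M - N\<close> and the three nontrivial cosets of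
  \<open>M\<close>. All five have a fine part, and the last three also a coarse one.\<close>

lemma card_idem_index:
  assumes "card (rcosets M) = 4"
  shows "card idem_index = 8"
proof -
  let ?out = "{C \<in> range conj_class. C \<inter> M = {}}"
  have disj: "(M #> x) \<inter> M = {}" if "x \<notin> M" for x
    using that coset_eq_iff[OF subgroup_M] blocks_coset[OF subgroup_M] unfolding blocks_def
    by (metis disjoint_iff)
  have out: "?out = (rcosets M) - {M}"
  proof (intro equalityI subsetI)
    fix C assume "C \<in> ?out"
    then obtain x where x: "C = conj_class x" "x \<notin> M"
      using conj_class_self by blast
    then have "C = M #> x" "M #> x \<noteq> M"
      using class_outside coset_eq_iff[OF subgroup_M] by auto
    then show "C \<in> (rcosets M) - {M}"
      by (auto simp: RCOSETS_def)
  next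
    fix C assume "C \<in> (rcosets M) - {M}"
    then obtain x where x: "C = M #> x" "M #> x \<noteq> M"
      by (auto simp: RCOSETS_def)
    then have "x \<notin> M"
      using coset_eq_iff[OF subgroup_M] by blast
    then show "C \<in> ?out"
      using x class_outside disj by (metis (mono_tags, lifting) mem_Collect_eq rangeI)
  qed
  have "M \<in> rcosets M"
    using coset_self[OF subgroup_M subgroup.one_closed[OF subgroup_M]] rcosetsI[of M \<one>] by simp
  then have card_out: "card ?out = 3"
    unfolding out using assms by (simp add: card_Diff_singleton)
  obtain x where x: "x \<in> N" "x \<noteq> \<one>"
    by (rule nontrivial_in_N)
  obtain y where y: "y \<in> M" "y \<notin> N"
    by (rule M_minus_N_nonempty)
  have inner: "range conj_class - {{\<one>}} = insert (N - {\<one>}) (insert (M - N) ?out)"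
  proof (intro equalityI subsetI)
    fix C assume "C \<in> range conj_class - {{\<one>}}"
    then obtain w where w: "C = conj_class w" "w \<noteq> \<one>"
      using conj_class_one by auto
    consider "w \<in> N" | "w \<in> M" "w \<notin> N" | "w \<notin> M"
      by blast
    then show "C \<in> insert (N - {\<one>}) (insert (M - N) ?out)"
    proof cases
      case 3
      then have "C = M #> w" "C \<inter> M = {}"
        using w(1) class_outside disj by simp_all
      then show ?thesis
        using w(1) by blast
    qed (use w class_in_N class_in_M in simp_all)
  next
    fix C assume "C \<in> insert (N - {\<one>}) (insert (M - N) ?out)"
    moreover have "N - {\<one>} \<in> range conj_class" "M - N \<in> range conj_class"
      using class_in_N[OF x] class_in_M[OF y] by blast+
    moreover have "M - N \<noteq> {\<one>}" "N - {\<one>} \<noteq> {\<one>}" "{\<one>} \<notin> ?out"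
      using one_in_N N_subset_M by auto
    ultimately show "C \<in> range conj_class - {{\<one>}}"
      by blast
  qed
  have "N - {\<one>} \<notin> insert (M - N) ?out" "M - N \<notin> ?out"
    using x y N_subset_M by blast+
  then have card_inner: "card (range conj_class - {{\<one>}}) = 5"
    unfolding inner by (simp add: card_out)
  have "({fine_part} \<times> (range conj_class - {{\<one>}})) \<inter> ({coarse_part} \<times> ?out) = {}"
    using coarse_neq_fine unfolding idem_index_def by fastforce
  then show ?thesis
    unfolding idem_index_def by (subst card_Un_disjoint) (simp_all add: card_cartesian_product card_inner card_out)
qed

end

section \<open>Conjugacy classes of a Frobenius group\<close>

locale frobenius_group_type = finite_group_type G for G :: "('g::finite) monoid" (structure) +
  fixes N H :: "'g set"
  assumes complement: "frobenius_complement G H" and kernel: "N = frobenius_kernel G H"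
    and normal: "N \<lhd> G" and product: "N <#> H = UNIV" and meet: "N \<inter> H = {\<one>}"
begin

lemma subgroup_H: "subgroup H G"
  using complement unfolding frobenius_complement_def by blast

lemma subgroup_N: "subgroup N G"
  by (rule normal_imp_subgroup[OF normal])

lemma conj_in_N: "n \<in> N \<Longrightarrow> g \<otimes> n \<otimes> inv g \<in> N"
  using normal.inv_op_closed2[OF normal] by simp

lemma factorize: obtains n h where "n \<in> N" "h \<in> H" "x = n \<otimes> h"
proof -
  have "x \<in> N <#> H"
    by (simp add: product)
  then show thesis
    using that unfolding set_mult_def by blast
qed

lemma conjugate_in_complement:
  assumes "x \<notin> N"
  obtains g h where "h \<in> H" "x = g \<otimes> h \<otimes> inv g"
proof -
  have "x \<in> (\<Union>g. g <# H #> inv g)"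
    using assms unfolding kernel frobenius_kernel_def by simp
  then show thesis
    using that unfolding l_coset_def r_coset_def by blast
qed

text \<open>An element of \<open>H\<close> that commutes with \<open>n\<close> lies in \<open>H\<close> and in its conjugate by \<open>n\<close>,
  which meet trivially since \<open>n \<notin> H\<close>. This makes \<open>H\<close> act freely on \<open>N - {\<one>}\<close>, and \<open>N\<close> on its
  cosets outside \<open>N\<close>, by conjugation.\<close>

lemma complement_acts_freely:
  assumes n: "n \<in> N" "n \<noteq> \<one>" and h: "h \<in> H" and comm: "n \<otimes> h \<otimes> inv n = h"
  shows "h = \<one>"
proof -
  have "n \<notin> H"
    using n meet by blast
  then have "H \<inter> (n <# H #> inv n) = {\<one>}"
    using complement unfolding frobenius_complement_def by simp
  moreover have "n \<otimes> h \<otimes> inv n \<in> n <# H #> inv n"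
    using h unfolding l_coset_def r_coset_def by blast
  ultimately show ?thesis
    using h comm by auto
qed

lemma conj_eq_iff: "g \<otimes> x \<otimes> inv g = k \<otimes> x \<otimes> inv k \<longleftrightarrow> (inv k \<otimes> g) \<otimes> x \<otimes> inv (inv k \<otimes> g) = x"
proof -
  have "(inv k \<otimes> g) \<otimes> x \<otimes> inv (inv k \<otimes> g) = inv k \<otimes> (g \<otimes> x \<otimes> inv g) \<otimes> inv (inv k)"
    by (simp only: conj_conj)
  moreover have "inv k \<otimes> w \<otimes> inv (inv k) = x \<longleftrightarrow> w = k \<otimes> x \<otimes> inv k" for w
    using inv_conj_conj by (metis UNIV_I carrier_UNIV inv_inv)
  ultimately show ?thesis
    by simp
qed

lemma commute_conj_iff: "g \<otimes> x \<otimes> inv g = x \<longleftrightarrow> x \<otimes> g \<otimes> inv x = g"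
  by (metis UNIV_I carrier_UNIV inv_solve_right m_closed)

lemma inv_mult_eq_one: "inv g \<otimes> h = \<one> \<longleftrightarrow> h = g"
  by (metis UNIV_I carrier_UNIV inv_equality inv_inv l_inv)

text \<open>The free action of \<open>H\<close> on \<open>N - {\<one>}\<close> is transitive, because the two sets are equally
  large.\<close>

lemma class_of_kernel_element:
  assumes card: "card N = card H + 1" and x: "x \<in> N" "x \<noteq> \<one>"
  shows "conj_class x = N - {\<one>}"
proof -
  let ?f = "\<lambda>h. h \<otimes> x \<otimes> inv h"
  have nontriv: "?f g \<in> N - {\<one>}" for g
  proof -
    have "?f g \<noteq> \<one>"
      using x(2) conj_mem_conj_class[of g x \<one>] by (simp add: conj_class_one)
    then show ?thesis
      using conj_in_N x(1) by simp
  qed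
  have "inj_on ?f H"
  proof (rule inj_onI)
    fix h k assume hk: "h \<in> H" "k \<in> H" "?f h = ?f k"
    let ?d = "inv k \<otimes> h"
    have d: "?d \<in> H"
      using hk subgroup.m_closed[OF subgroup_H] subgroup.m_inv_closed[OF subgroup_H] by simp
    moreover have "x \<otimes> ?d \<otimes> inv x = ?d"
      using hk(3) conj_eq_iff commute_conj_iff by metis
    ultimately have "?d = \<one>"
      using complement_acts_freely x by blast
    then show "h = k"
      by (simp add: inv_mult_eq_one)
  qed
  then have "card (?f ` H) = card (N - {\<one>})"
    using card subgroup.one_closed[OF subgroup_N] by (simp add: card_image)
  then have "?f ` H = N - {\<one>}"
    using nontriv by (intro card_subset_eq) auto
  then show ?thesis
    using nontriv by (auto simp: conj_class_def)
qed

text \<open>As \<open>x\<close> is conjugate to an element of \<open>H\<close>, no nontrivial element of \<open>N\<close> commutes with it. Hence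
  its conjugates by the elements of \<open>N\<close> are distinct, and there are enough of them to fill the
  coset.\<close>

lemma coset_subset_class:
  assumes x: "x \<notin> N"
  shows "N #> x \<subseteq> conj_class x"
proof -
  let ?f = "\<lambda>n. n \<otimes> x \<otimes> inv n"
  have "?f ` N \<subseteq> N #> x"
  proof (rule image_subsetI)
    fix n assume n: "n \<in> N"
    have "?f n \<otimes> inv x = n \<otimes> (x \<otimes> inv n \<otimes> inv x)"
      by (simp add: m_assoc)
    moreover have "x \<otimes> inv n \<otimes> inv x \<in> N"
      using n by (intro conj_in_N subgroup.m_inv_closed[OF subgroup_N])
    ultimately show "?f n \<in> N #> x"
      using n subgroup.m_closed[OF subgroup_N] by (simp add: mem_coset)
  qed
  moreover have "inj_on ?f N"
  proof (rule inj_onI)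
    fix n m assume nm: "n \<in> N" "m \<in> N" "?f n = ?f m"
    define d where "d = inv m \<otimes> n"
    have d: "d \<in> N"
      using nm unfolding d_def using subgroup.m_closed[OF subgroup_N] subgroup.m_inv_closed[OF subgroup_N] by simp
    obtain g h where h: "h \<in> H" "x = g \<otimes> h \<otimes> inv g"
      by (rule conjugate_in_complement[OF x])
    let ?e = "inv g \<otimes> d \<otimes> inv (inv g)"
    have "inv g \<otimes> x \<otimes> inv (inv g) = h"
      by (simp add: h)
    moreover have "d \<otimes> x \<otimes> inv d = x"
      using nm(3) conj_eq_iff unfolding d_def by blast
    then have "inv g \<otimes> (d \<otimes> x \<otimes> inv d) \<otimes> inv (inv g) = inv g \<otimes> x \<otimes> inv (inv g)"
      by (simp only:)
    ultimately have "?e \<otimes> h \<otimes> inv ?e = h"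
      by (simp only: conj_inv flip: conj_mult)
    moreover have "h \<noteq> \<one>"
      using x h(2) subgroup.one_closed[OF subgroup_N] by auto
    ultimately have "?e = \<one>"
      using complement_acts_freely[OF conj_in_N[OF d, of "inv g"] _ h(1)] by blast
    then have "d \<in> conj_class \<one>"
      using conj_mem_conj_class[of "inv g" d \<one>] by (simp add: conj_class_one)
    then have "d = \<one>"
      by (simp add: conj_class_one)
    then show "n = m"
      unfolding d_def by (simp add: inv_mult_eq_one)
  qed
  then have "card (?f ` N) = card (N #> x)"
    by (simp add: card_image card_coset[OF subgroup_N])
  ultimately have "?f ` N = N #> x"
    by (intro card_subset_eq) simp_all
  then show ?thesis
    by (auto simp: conj_class_def)
qed

lemma card_product: "card (UNIV :: 'g set) = card N * card H"
proof -
  have "inj_on (\<lambda>(n, h). n \<otimes> h) (N \<times> H)"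
  proof (rule inj_onI, clarify)
    fix n h m k assume nm: "n \<in> N" "h \<in> H" "m \<in> N" "k \<in> H" and eq: "n \<otimes> h = m \<otimes> k"
    have "inv m \<otimes> n = inv m \<otimes> (n \<otimes> h) \<otimes> inv h"
      by (simp add: m_assoc)
    also have "\<dots> = k \<otimes> inv h"
      unfolding eq by (simp flip: m_assoc)
    finally have "inv m \<otimes> n = k \<otimes> inv h" .
    moreover have "inv m \<otimes> n \<in> N" "k \<otimes> inv h \<in> H"
      using nm subgroup.m_closed[OF subgroup_N] subgroup.m_inv_closed[OF subgroup_N]
        subgroup.m_closed[OF subgroup_H] subgroup.m_inv_closed[OF subgroup_H] by simp_all
    ultimately have "inv m \<otimes> n \<in> N \<inter> H"
      by simp
    then have "n = m"
      by (simp add: meet inv_mult_eq_one)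
    then show "n = m \<and> h = k"
      using eq by simp
  qed
  then have "card ((\<lambda>(n, h). n \<otimes> h) ` (N \<times> H)) = card N * card H"
    by (simp add: card_image card_cartesian_product)
  moreover have "x \<in> (\<lambda>(n, h). n \<otimes> h) ` (N \<times> H)" for x
  proof -
    obtain n h where "n \<in> N" "h \<in> H" "x = n \<otimes> h"
      by (rule factorize)
    then show ?thesis
      by (intro image_eqI[of _ _ "(n, h)"]) simp_all
  qed
  then have "(\<lambda>(n, h). n \<otimes> h) ` (N \<times> H) = UNIV"
    by blast
  ultimately show ?thesis
    by simp
qed

text \<open>The hypotheses on \<open>z\<close> say that \<open>{\<one>, z}\<close> is central in \<open>H\<close> and contains all commutators of
  \<open>H\<close>, and that an element \<open>h\<close> outside of it has the commutator \<open>z\<close> with some \<open>k\<close>. The class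
  of \<open>h\<close> in \<open>H\<close> is then \<open>{h, z h}\<close>. As the classes outside \<open>N\<close> are unions of cosets of \<open>N\<close>,
  the class of \<open>h\<close> in \<open>G\<close> is the union of the cosets of \<open>h\<close> and \<open>z h\<close>, i.e. a coset of \<open>N {\<one>, z}\<close>.
  In the same way, the class of \<open>z\<close> is the single coset \<open>N z\<close>.\<close>

lemma layered:
  assumes card: "card N = card H + 1" "2 < card N"
    and z: "z \<in> H" "z \<noteq> \<one>" "z \<otimes> z = \<one>" and central: "\<And>h. h \<in> H \<Longrightarrow> h \<otimes> z = z \<otimes> h"
    and commutators: "\<And>h k. h \<in> H \<Longrightarrow> k \<in> H \<Longrightarrow> k \<otimes> h = h \<otimes> k \<or> k \<otimes> h = z \<otimes> h \<otimes> k"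
    and noncentral: "\<And>h. h \<in> H \<Longrightarrow> h \<noteq> \<one> \<Longrightarrow> h \<noteq> z \<Longrightarrow> \<exists>k\<in>H. k \<otimes> h = z \<otimes> h \<otimes> k"
  shows "layered_group G N (N <#> {\<one>, z})"
proof -
  define M where "M = N <#> {\<one>, z}"
  have M_eq: "M = N \<union> (N #> z)"
    by (auto simp: M_def set_mult_def r_coset_def)
  have "inv z = z"
    using z(3) by (simp add: inv_equality)
  then have "subgroup {\<one>, z} G"
    using z(3) by unfold_locales auto
  then have subgroup_M: "subgroup M G"
    unfolding M_def by (rule mult_norm_subgroup[OF normal])
  have zN: "z \<notin> N"
    using z meet by blast
  then have disjoint: "N \<inter> (N #> z) = {}"
    using coset_eq_iff[OF subgroup_N] blocks_coset[OF subgroup_N] unfolding blocks_def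
    by (metis disjoint_iff coset_self[OF subgroup_N])
  have M_coset: "M #> h = (N #> h) \<union> (N #> (z \<otimes> h))" for h
    unfolding M_eq by (auto simp: r_coset_def m_assoc)
  have conj_in_coset: "n \<otimes> y \<otimes> inv n \<in> N #> y" if "n \<in> N" for n y
  proof -
    have "(n \<otimes> y \<otimes> inv n) \<otimes> inv y = n \<otimes> (y \<otimes> inv n \<otimes> inv y)"
      by (simp add: m_assoc)
    moreover have "y \<otimes> inv n \<otimes> inv y \<in> N"
      using that by (intro conj_in_N subgroup.m_inv_closed[OF subgroup_N])
    ultimately show ?thesis
      using that subgroup.m_closed[OF subgroup_N] by (simp add: mem_coset)
  qed
  have conj_subset: "conj_class h \<subseteq> U" if "\<And>k. k \<in> H \<Longrightarrow> N #> (k \<otimes> h \<otimes> inv k) \<subseteq> U" for h U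
  proof
    fix w assume "w \<in> conj_class h"
    then obtain g where g: "w = g \<otimes> h \<otimes> inv g"
      unfolding mem_conj_class by blast
    obtain n k where nk: "n \<in> N" "k \<in> H" "g = n \<otimes> k"
      by (rule factorize)
    have "w = n \<otimes> (k \<otimes> h \<otimes> inv k) \<otimes> inv n"
      by (simp only: g nk(3) conj_conj)
    then show "w \<in> U"
      using conj_in_coset[OF nk(1)] that[OF nk(2)] by blast
  qed
  have conj_solve: "k \<otimes> h \<otimes> inv k = w" if "k \<otimes> h = w \<otimes> k" for k h w
    using that by (simp add: m_assoc)
  show ?thesis
    unfolding M_def[symmetric]
  proof (intro layered_group.intro layered_group_axioms.intro finite_group_type_axioms)
    show "subgroup N G" "subgroup M G"
      by (rule subgroup_N subgroup_M)+
    show "N \<subseteq> M"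
      by (simp add: M_eq)
    show "card M = 2 * card N"
      unfolding M_eq using disjoint by (simp add: card_Un_disjoint card_coset[OF subgroup_N])
    show "2 < card N"
      by (rule card)
  next
    fix x assume "x \<in> N" "x \<noteq> \<one>"
    then show "conj_class x = N - {\<one>}"
      by (rule class_of_kernel_element[OF card(1)])
  next
    fix x assume x: "x \<in> M" "x \<notin> N"
    have MN: "M - N = N #> z"
      using disjoint by (auto simp: M_eq)
    then have "x \<in> N #> z"
      using x by blast
    then have "x \<in> conj_class z"
      using coset_subset_class[OF zN] by blast
    then have "conj_class x = conj_class z"
      by (rule conj_class_eq)
    moreover have "conj_class z \<subseteq> N #> z"
    proof (rule conj_subset)
      fix k assume "k \<in> H"
      then have "k \<otimes> z \<otimes> inv k = z"
        by (intro conj_solve central)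
      then show "N #> (k \<otimes> z \<otimes> inv k) \<subseteq> N #> z"
        by (simp only:)
    qed
    ultimately show "conj_class x = M - N"
      using coset_subset_class[OF zN] MN by simp
  next
    fix x assume x: "x \<notin> M"
    obtain n h where nh: "n \<in> N" "h \<in> H" "x = n \<otimes> h"
      by (rule factorize)
    have xh: "x \<in> N #> h"
      using nh unfolding r_coset_def by blast
    have hM: "h \<notin> M"
    proof
      assume "h \<in> M"
      moreover have "n \<in> M"
        using nh by (simp add: M_eq)
      ultimately show False
        using x nh subgroup.m_closed[OF subgroup_M] by simp
    qed
    then have h: "h \<notin> N" "h \<noteq> \<one>" "h \<noteq> z"
      using subgroup.one_closed[OF subgroup_M] blocks_coset[OF subgroup_N]
      unfolding M_eq blocks_def by blast+
    then obtain k where k: "k \<in> H" "k \<otimes> h = z \<otimes> h \<otimes> k"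
      using noncentral[OF nh(2)] by blast
    have "x \<in> conj_class h"
      using coset_subset_class[OF h(1)] xh by blast
    then have class_x: "conj_class x = conj_class h"
      by (rule conj_class_eq)
    have "z \<otimes> h \<in> conj_class h"
      using conj_solve[OF k(2)] unfolding mem_conj_class by metis
    then have class_zh: "conj_class (z \<otimes> h) = conj_class h"
      by (rule conj_class_eq)
    have "z \<otimes> h \<notin> N"
    proof
      assume zh: "z \<otimes> h \<in> N"
      have "k \<otimes> h \<otimes> inv k \<in> N"
        using conj_solve[OF k(2)] zh by simp
      then have "inv k \<otimes> (k \<otimes> h \<otimes> inv k) \<otimes> inv (inv k) \<in> N"
        by (rule conj_in_N)
      then show False
        using h(1) by simp
    qed
    then have "M #> h \<subseteq> conj_class h"
      using coset_subset_class[of "z \<otimes> h"] coset_subset_class[OF h(1)] class_zh M_coset by simp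
    moreover have "conj_class h \<subseteq> M #> h"
    proof (rule conj_subset)
      fix l assume "l \<in> H"
      then have "l \<otimes> h \<otimes> inv l = h \<or> l \<otimes> h \<otimes> inv l = z \<otimes> h"
        using commutators[OF nh(2)] conj_solve by blast
      then show "N #> (l \<otimes> h \<otimes> inv l) \<subseteq> M #> h"
        unfolding M_coset by auto
    qed
    moreover have "M #> x = M #> h"
    proof -
      have "x \<in> M #> h"
        using xh unfolding M_coset by blast
      then show ?thesis
        using blocks_coset[OF subgroup_M] unfolding blocks_def by blast
    qed
    ultimately show "conj_class x = M #> x"
      using class_x by simp
  qed
qed

end

section \<open>The quaternion group\<close>

lemma quaternion_commutators:
  assumes "a \<in> carrier quaternion_group" "b \<in> carrier quaternion_group"
  shows "quaternion_mult a b = quaternion_mult b a \<or>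
    quaternion_mult a b = quaternion_mult (quaternion_mult (-1, 0, 0, 0) b) a"
  using assms unfolding quaternion_group_def by auto

lemma quaternion_noncentral:
  assumes "b \<in> carrier quaternion_group" "b \<noteq> (1, 0, 0, 0)" "b \<noteq> (-1, 0, 0, 0)"
  shows "\<exists>a\<in>carrier quaternion_group.
    quaternion_mult a b = quaternion_mult (quaternion_mult (-1, 0, 0, 0) b) a"
  using assms unfolding quaternion_group_def by auto

lemma quaternion_idempotent:
  assumes "a \<in> carrier quaternion_group" "quaternion_mult a a = a"
  shows "a = (1, 0, 0, 0)"
  using assms unfolding quaternion_group_def by auto

lemma quaternion_involution_central:
  "quaternion_mult a (-1, 0, 0, 0) = quaternion_mult (-1, 0, 0, 0) a"
  by (cases a) simp

lemma card_quaternion_group: "card (carrier quaternion_group) = 8"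
  by (simp add: quaternion_group_def)

lemma card_integer_mod_group: "0 < n \<Longrightarrow> card (carrier (integer_mod_group n)) = n"
  by (simp add: carrier_integer_mod_group)

theorem theorem5p15:
  fixes G :: "('g::finite) monoid" and N H :: "'g set"
  assumes "group G" and "carrier G = UNIV"
    and "frobenius_complement G H" and "N = frobenius_kernel G H"
    and "N \<lhd> G" and "N <#>\<^bsub>G\<^esub> H = carrier G" and "N \<inter> H = {\<one>\<^bsub>G\<^esub>}"
    and "G\<lparr>carrier := N\<rparr> \<cong> integer_mod_group 3 \<times>\<times> integer_mod_group 3"
    and "G\<lparr>carrier := H\<rparr> \<cong> quaternion_group"
  shows "\<exists>V (Z :: nat \<Rightarrow> (complex^'g^'g) set).
           is_primary_component G V \<and>
           (\<forall>i \<in> {1..8}. two_sided_ideal (terwilliger_algebra G) (Z i) \<and> cmat.dim (Z i) = 1) \<and>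
           inj_on Z {1..8} \<and> V \<notin> Z ` {1..8} \<and>
           wedderburn_decomposition (terwilliger_algebra G) (insert V (Z ` {1..8}))"
proof -
  interpret group G
    by fact
  interpret frobenius_group_type G N H
    by (intro frobenius_group_type.intro finite_group_type.intro finite_group_type_axioms.intro
        frobenius_group_type_axioms.intro; fact assms(1-5,7) assms(6)[unfolded assms(2)])
  have cardN: "card N = 9"
    using iso_same_card[OF assms(8)] by (simp add: card_cartesian_product card_integer_mod_group)
  have cardH: "card H = 8"
    using iso_same_card[OF assms(9)] by (simp add: card_quaternion_group)
  obtain \<psi> where \<psi>: "\<psi> \<in> iso (G\<lparr>carrier := H\<rparr>) quaternion_group"
    using assms(9) unfolding is_iso_def by blast
  have hom: "\<psi> (h \<otimes>\<^bsub>G\<^esub> k) = quaternion_mult (\<psi> h) (\<psi> k)" if "h \<in> H" "k \<in> H" for h k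
    using \<psi> that by (simp add: iso_def hom_def quaternion_group_def)
  have bij: "bij_betw \<psi> H (carrier quaternion_group)"
    using \<psi> by (simp add: iso_def)
  have mem: "\<psi> h \<in> carrier quaternion_group" if "h \<in> H" for h
    using bij that by (rule bij_betw_apply)
  have inj: "\<psi> h = \<psi> k \<longleftrightarrow> h = k" if "h \<in> H" "k \<in> H" for h k
    using bij_betw_imp_inj_on[OF bij] that by (meson inj_onD)
  note closed = subgroup.m_closed[OF subgroup_H]
  have one: "\<one>\<^bsub>G\<^esub> \<in> H"
    by (rule subgroup.one_closed[OF subgroup_H])
  have \<psi>_one: "\<psi> \<one>\<^bsub>G\<^esub> = (1, 0, 0, 0)"
  proof -
    have "quaternion_mult (\<psi> \<one>\<^bsub>G\<^esub>) (\<psi> \<one>\<^bsub>G\<^esub>) = \<psi> \<one>\<^bsub>G\<^esub>"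
      using hom[OF one one] by simp
    then show ?thesis
      by (rule quaternion_idempotent[OF mem[OF one]])
  qed
  have "(-1, 0, 0, 0) \<in> \<psi> ` H"
    using bij_betw_imp_surj_on[OF bij] by (simp add: quaternion_group_def)
  then obtain z where z: "z \<in> H" "\<psi> z = (-1, 0, 0, 0)"
    by force
  let ?M = "N <#>\<^bsub>G\<^esub> {\<one>\<^bsub>G\<^esub>, z}"
  interpret layered_group G N ?M
  proof (rule layered)
    show "z \<noteq> \<one>\<^bsub>G\<^esub>"
      using z(2) \<psi>_one by auto
    show "z \<otimes>\<^bsub>G\<^esub> z = \<one>\<^bsub>G\<^esub>"
      using hom[OF z(1) z(1)] z \<psi>_one inj[OF closed[OF z(1) z(1)] one] by simp
    fix h assume h: "h \<in> H"
    show "h \<otimes>\<^bsub>G\<^esub> z = z \<otimes>\<^bsub>G\<^esub> h"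
      using inj[OF closed[OF h z(1)] closed[OF z(1) h]] hom h z quaternion_involution_central by simp
    have twisted: "k \<otimes>\<^bsub>G\<^esub> h = z \<otimes>\<^bsub>G\<^esub> h \<otimes>\<^bsub>G\<^esub> k \<longleftrightarrow>
        quaternion_mult (\<psi> k) (\<psi> h) = quaternion_mult (quaternion_mult (-1, 0, 0, 0) (\<psi> h)) (\<psi> k)"
      if k: "k \<in> H" for k
      using inj[OF closed[OF k h] closed[OF closed[OF z(1) h] k]] hom[OF k h] hom[OF closed[OF z(1) h] k]
        hom[OF z(1) h] z(2) by simp
    show "k \<otimes>\<^bsub>G\<^esub> h = h \<otimes>\<^bsub>G\<^esub> k \<or> k \<otimes>\<^bsub>G\<^esub> h = z \<otimes>\<^bsub>G\<^esub> h \<otimes>\<^bsub>G\<^esub> k" if k: "k \<in> H" for k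
      using quaternion_commutators[OF mem[OF k] mem[OF h]] twisted[OF k]
        inj[OF closed[OF k h] closed[OF h k]] hom[OF k h] hom[OF h k] by argo
    assume "h \<noteq> \<one>\<^bsub>G\<^esub>" "h \<noteq> z"
    then have "\<psi> h \<noteq> (1, 0, 0, 0)" "\<psi> h \<noteq> (-1, 0, 0, 0)"
      using inj[OF h one] inj[OF h z(1)] \<psi>_one z(2) by auto
    then obtain a where a: "a \<in> carrier quaternion_group"
      "quaternion_mult a (\<psi> h) = quaternion_mult (quaternion_mult (-1, 0, 0, 0) (\<psi> h)) a"
      using quaternion_noncentral[OF mem[OF h]] by blast
    then obtain k where "k \<in> H" "a = \<psi> k"
      using bij_betw_imp_surj_on[OF bij] by blast
    then show "\<exists>k\<in>H. k \<otimes>\<^bsub>G\<^esub> h = z \<otimes>\<^bsub>G\<^esub> h \<otimes>\<^bsub>G\<^esub> k"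
      using a(2) twisted by blast
  qed (simp_all add: cardN cardH z)
  have "card (rcosets\<^bsub>G\<^esub> ?M) * card ?M = 72"
    using lagrange[OF subgroup_M] card_product by (simp only: order_def assms(2) cardN cardH)
  moreover have "card ?M = 18"
    by (simp only: card_M cardN)
  ultimately have "card (rcosets\<^bsub>G\<^esub> ?M) = 4"
    by simp
  then have "card idem_index = 8"
    by (rule card_idem_index)
  then obtain f where f: "bij_betw f {1..8::nat} idem_index"
    using ex_bij_betw_nat_finite_1[OF finite_idem_index] by auto
  let ?Z = "\<lambda>i. cmat.span {idem (f i)}"
  have image: "?Z ` {1..8} = (\<lambda>i. cmat.span {idem i}) ` idem_index"
    unfolding bij_betw_imp_surj_on[OF f, symmetric] image_image ..
  have f_mem: "f i \<in> idem_index" if "i \<in> {1..8}" for i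
    using f that by (rule bij_betw_apply)
  have inj_Z: "inj_on ?Z {1..8}"
    using comp_inj_on[of f "{1..8}" "\<lambda>i. cmat.span {idem i}"] bij_betw_imp_inj_on[OF f] inj_idem_line
    unfolding bij_betw_imp_surj_on[OF f] comp_def .
  show ?thesis
  proof (intro exI[of _ class_blocks] exI[of _ ?Z] conjI ballI)
    show "is_primary_component G class_blocks"
      by (rule primary_component_class_blocks)
    show "two_sided_ideal (terwilliger_algebra G) (?Z i)" if "i \<in> {1..8}" for i
      by (rule idem_ideal[OF f_mem[OF that]])
    show "cmat.dim (?Z i) = 1" if "i \<in> {1..8}" for i
      by (rule dim_line[OF idem_nonzero[OF f_mem[OF that]]])
    show "inj_on ?Z {1..8}"
      by (rule inj_Z)
    show "class_blocks \<notin> ?Z ` {1..8}"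
      using class_blocks_acts idem_not_acts unfolding image by auto
    show "wedderburn_decomposition (terwilliger_algebra G) (insert class_blocks (?Z ` {1..8}))"
      unfolding image by (rule wedderburn)
  qed
qed

end
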